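(* Let $0<\alpha_1\le\alpha_2$ and $p\in(0,1]$ be constants. There exist $c>0$ and $d_0\ge2$, depending only on $\alpha_1,\alpha_2,p$, such that the following holds for all integers $d\ge d_0$, all positive integers $a$, all $\alpha\in[\alpha_1,\alpha_2]$ and all $\Delta$ with $0<\Delta\le\alpha$. Consider the Hamiltonians $H_z=-\Delta|z\rangle\langle z|$ on $\mathbb{C}^d$, $z\in\{1,\dots,d\}$ (each with unique ground state $|z\rangle$ and spectral gap $\Delta$), and the initial state $|\phi_0\rangle=\frac{1}{\sqrt d}\sum_{x=1}^d|x\rangle$, whose overlap with every ground state is $\gamma=|\langle z|\phi_0\rangle|=1/\sqrt d$. Suppose a $Q$-query algorithm with the initial state $|\phi_0\rangle$ available has the property that, for every $z$ and every $(\alpha,a,0)$-block encoding $U_H$ of $H=H_z$, given query access to $\mathcal{U}_H$ and $\mathcal{U}_H^\dagger$ it outputs, with success probability at least $p$, a state $\hat\rho$ satisfying $\langle z|\hat\rho|z\rangle\ge\frac34$. Then $$Q\ \ge\ c\,\frac{\sqrt d}{\Delta}=\frac{c}{\gamma\Delta}.$$ That is, for $\alpha=\Theta(1)$, ground-state preparation for this family with constant success probability requires $\Omega(\sqrt d/\Delta)=\Omega(1/(\gamma\Delta))$ queries in total to $\mathcal{U}_H$ and $\mathcal{U}_H^\dagger$.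
   Context: $\{|x\rangle\}_{x=1}^d$ is the computational basis of $\mathbb{C}^d$. Block encoding: a unitary $U$ on $(\mathbb{C}^2)^{\otimes a}\otimes\mathbb{C}^d$ is an $(\alpha,a,0)$-block encoding of an operator $A$ on $\mathbb{C}^d$ if $\alpha(\langle 0|^{\otimes a}\otimes I)U(|0\rangle^{\otimes a}\otimes I)=A$. For a unitary $U_H$, put $\mathcal{U}_H(\cdot)=U_H(\cdot)U_H^\dagger$ and $\mathcal{U}_H^\dagger(\cdot)=U_H^\dagger(\cdot)U_H$. A $Q$-query algorithm starts from a fixed initial state on a finite-dimensional workspace (which may include copies of $|\phi_0\rangle$), applies fixed unitary channels, independent of $z$ and $U_H$, interleaved with $Q$ queries in total, each of a prescribed type $\mathcal{U}_H$ or $\mathcal{U}_H^\dagger$, acting on a designated $(\mathbb{C}^2)^{\otimes a}\otimes\mathbb{C}^d$ subsystem, then possibly performs a fixed measurement on part of the workspace, and outputs the state of a designated $d$-dimensional subsystem. "With success probability at least $p$ outputs a state with a given property" means that, with probability at least $p$ over the measurement outcomes, the post-measurement output state has the property. *)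

theory Defs
  imports "Jordan_Normal_Form.Spectral_Radius" "Jordan_Normal_Form.Schur_Decomposition"
begin

text \<open>
  Operators on $\mathbb{C}^n$ are complex $n \times n$ matrices. Basis labels are
  zero-based: \<^term>\<open>ket d z\<close> with \<^term>\<open>z < d\<close> stands for the basis vector usually
  labelled $z + 1$. Note that \<^term>\<open>v \<bullet>c w\<close> is conjugate-linear in its second
  argument, so $\langle w | v \rangle$ is \<^term>\<open>v \<bullet>c w\<close>.
\<close>

subsection \<open>Linear algebra\<close>

abbreviation ket :: "nat \<Rightarrow> nat \<Rightarrow> complex vec" where
  "ket d z \<equiv> unit_vec d z"

definition outer_prod :: "complex vec \<Rightarrow> complex vec \<Rightarrow> complex mat" where
  "outer_prod v w = mat (dim_vec v) (dim_vec w) (\<lambda>(i, j). v $ i * cnj (w $ j))"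

definition uniform_state :: "nat \<Rightarrow> complex vec" where
  "uniform_state d = complex_of_real (1 / sqrt (real d)) \<cdot>\<^sub>v vec d (\<lambda>_. 1)"

definition expval :: "complex mat \<Rightarrow> complex vec \<Rightarrow> complex" where
  "expval A v = (A *\<^sub>v v) \<bullet>c v"

definition mtrace :: "complex mat \<Rightarrow> complex" where
  "mtrace A = (\<Sum>i<dim_row A. A $$ (i, i))"

definition is_unitary :: "nat \<Rightarrow> complex mat \<Rightarrow> bool" where
  "is_unitary n U \<longleftrightarrow>
     U \<in> carrier_mat n n \<and> mat_adjoint U * U = 1\<^sub>m n \<and> U * mat_adjoint U = 1\<^sub>m n"

definition density_operator :: "nat \<Rightarrow> complex mat \<Rightarrow> bool" where
  "density_operator n \<rho> \<longleftrightarrow>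
     \<rho> \<in> carrier_mat n n \<and>
     (\<forall>v\<in>carrier_vec n. expval \<rho> v \<in> \<real> \<and> 0 \<le> Re (expval \<rho> v)) \<and>
     mtrace \<rho> = 1"

definition conj_by :: "complex mat \<Rightarrow> complex mat \<Rightarrow> complex mat" where
  "conj_by V \<rho> = V * \<rho> * mat_adjoint V"

definition kron :: "complex mat \<Rightarrow> complex mat \<Rightarrow> complex mat" where
  "kron A B = mat (dim_row A * dim_row B) (dim_col A * dim_col B)
     (\<lambda>(i, j). A $$ (i div dim_row B, j div dim_col B) * B $$ (i mod dim_row B, j mod dim_col B))"

primrec kron_pow :: "complex mat \<Rightarrow> nat \<Rightarrow> complex mat" where
  "kron_pow A 0 = 1\<^sub>m 1"
| "kron_pow A (Suc n) = kron A (kron_pow A n)"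

subsection \<open>Hamiltonians and block encodings\<close>

text \<open>The following three notions are meant for Hermitian \<^term>\<open>H\<close>, whose spectrum is real.\<close>

definition ground_energy :: "complex mat \<Rightarrow> real" where
  "ground_energy H = Min (Re ` spectrum H)"

definition ground_state :: "complex mat \<Rightarrow> complex vec \<Rightarrow> bool" where
  "ground_state H v \<longleftrightarrow> eigenvector H v (complex_of_real (ground_energy H)) \<and> v \<bullet>c v = 1"

definition spectral_gap :: "complex mat \<Rightarrow> real" where
  "spectral_gap H = Min (Re ` spectrum H - {ground_energy H}) - ground_energy H"

text \<open>Uniqueness is up to a scalar factor.\<close>

definition unique_ground_state :: "complex mat \<Rightarrow> complex vec \<Rightarrow> bool" where
  "unique_ground_state H v \<longleftrightarrow>
     ground_state H v \<and> (\<forall>w. ground_state H w \<longrightarrow> (\<exists>k. w = k \<cdot>\<^sub>v v))"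

definition search_hamiltonian :: "nat \<Rightarrow> real \<Rightarrow> nat \<Rightarrow> complex mat" where
  "search_hamiltonian d \<Delta> z = complex_of_real (- \<Delta>) \<cdot>\<^sub>m outer_prod (ket d z) (ket d z)"

text \<open>
  The isometry $|0\rangle^{\otimes a} \otimes I$ from $\mathbb{C}^d$ to
  $(\mathbb{C}^2)^{\otimes a} \otimes \mathbb{C}^d$; the basis vector
  $|b\rangle \otimes |x\rangle$ of the latter has index $b d + x$.
\<close>

definition ancilla_isometry :: "nat \<Rightarrow> nat \<Rightarrow> complex mat" where
  "ancilla_isometry a d = kron (kron_pow (mat_of_cols 2 [ket 2 0]) a) (1\<^sub>m d)"

definition block_encoding :: "real \<Rightarrow> nat \<Rightarrow> nat \<Rightarrow> complex mat \<Rightarrow> complex mat \<Rightarrow> bool" where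
  "block_encoding \<alpha> a d U A \<longleftrightarrow>
     is_unitary (2 ^ a * d) U \<and>
     complex_of_real \<alpha> \<cdot>\<^sub>m
       (mat_adjoint (ancilla_isometry a d) * U * ancilla_isometry a d) = A"

subsection \<open>Subsystems\<close>

text \<open>
  A subsystem of $\mathbb{C}^N$ is a factorisation $\mathbb{C}^N \cong
  \mathbb{C}^k \otimes \mathbb{C}^m$ of the computational basis: \<^term>\<open>sub_index S x r\<close>
  is the index in $\{0,\dots,N-1\}$ of the basis vector $|x\rangle \otimes |r\rangle$, with
  $x$ labelling the subsystem and $r$ the rest of the workspace. Any group of tensor
  factors of a workspace, in any order and position, is of this form.
\<close>

record subsystem =
  sub_dim :: nat
  env_dim :: nat
  sub_index :: "nat \<Rightarrow> nat \<Rightarrow> nat"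

definition is_subsystem :: "nat \<Rightarrow> subsystem \<Rightarrow> bool" where
  "is_subsystem N S \<longleftrightarrow>
     bij_betw (\<lambda>(x, r). sub_index S x r) ({..<sub_dim S} \<times> {..<env_dim S}) {..<N}"

definition sub_coords :: "subsystem \<Rightarrow> nat \<Rightarrow> nat \<times> nat" where
  "sub_coords S = inv_into ({..<sub_dim S} \<times> {..<env_dim S}) (\<lambda>(x, r). sub_index S x r)"

text \<open>\<open>apply_on N S A\<close> is $A \otimes I$ with respect to the factorisation \<^term>\<open>S\<close>.\<close>

definition apply_on :: "nat \<Rightarrow> subsystem \<Rightarrow> complex mat \<Rightarrow> complex mat" where
  "apply_on N S A = mat N N
     (\<lambda>(i, j). case (sub_coords S i, sub_coords S j) of
        ((x, r), (y, s)) \<Rightarrow> if r = s then A $$ (x, y) else 0)"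

text \<open>Partial trace over everything but the subsystem.\<close>

definition reduced_state :: "subsystem \<Rightarrow> complex mat \<Rightarrow> complex mat" where
  "reduced_state S \<rho> = mat (sub_dim S) (sub_dim S)
     (\<lambda>(x, y). \<Sum>r<env_dim S. \<rho> $$ (sub_index S x r, sub_index S y r))"

subsection \<open>Query algorithms\<close>

datatype query_type = Query | Query_Adjoint

primrec query_unitary :: "query_type \<Rightarrow> complex mat \<Rightarrow> complex mat" where
  "query_unitary Query U = U"
| "query_unitary Query_Adjoint U = mat_adjoint U"

text \<open>
  An element \<open>(t, V)\<close> of \<open>query_steps\<close> is a query of type \<open>t\<close> followed by the fixed unitary
  \<open>V\<close>. The initial state is an arbitrary fixed density operator of the workspace, so it may
  in particular contain any number of copies of \<^term>\<open>uniform_state d\<close>. The final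
  measurement is given by measurement operators on the subsystem \<open>meas_sub\<close>; performing no
  measurement is the case of the identity as the single operator.
\<close>

record query_algorithm =
  ws_dim :: nat
  init_state :: "complex mat"
  init_unitary :: "complex mat"
  query_sub :: subsystem
  query_steps :: "(query_type \<times> complex mat) list"
  meas_sub :: subsystem
  meas_ops :: "complex mat list"
  out_sub :: subsystem

definition measurement :: "nat \<Rightarrow> complex mat list \<Rightarrow> bool" where
  "measurement n Ms \<longleftrightarrow>
     set Ms \<subseteq> carrier_mat n n \<and>
     foldr (\<lambda>M S. mat_adjoint M * M + S) Ms (0\<^sub>m n n) = 1\<^sub>m n"

text \<open>The algorithm has queries to a unitary on $(\mathbb{C}^2)^{\otimes a} \otimes \mathbb{C}^d$
  and a \<open>d\<close>-dimensional output.\<close>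

definition valid_algorithm :: "nat \<Rightarrow> nat \<Rightarrow> query_algorithm \<Rightarrow> bool" where
  "valid_algorithm a d \<A> \<longleftrightarrow>
     density_operator (ws_dim \<A>) (init_state \<A>) \<and>
     is_unitary (ws_dim \<A>) (init_unitary \<A>) \<and>
     (\<forall>(t, V)\<in>set (query_steps \<A>). is_unitary (ws_dim \<A>) V) \<and>
     is_subsystem (ws_dim \<A>) (query_sub \<A>) \<and> sub_dim (query_sub \<A>) = 2 ^ a * d \<and>
     is_subsystem (ws_dim \<A>) (meas_sub \<A>) \<and>
     measurement (sub_dim (meas_sub \<A>)) (meas_ops \<A>) \<and>
     is_subsystem (ws_dim \<A>) (out_sub \<A>) \<and> sub_dim (out_sub \<A>) = d"

definition num_queries :: "query_algorithm \<Rightarrow> nat" where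
  "num_queries \<A> = length (query_steps \<A>)"

definition final_state :: "query_algorithm \<Rightarrow> complex mat \<Rightarrow> complex mat" where
  "final_state \<A> U =
     foldl (\<lambda>\<rho> (t, V). conj_by V
              (conj_by (apply_on (ws_dim \<A>) (query_sub \<A>) (query_unitary t U)) \<rho>))
       (conj_by (init_unitary \<A>) (init_state \<A>)) (query_steps \<A>)"

definition post_state :: "query_algorithm \<Rightarrow> complex mat \<Rightarrow> nat \<Rightarrow> complex mat" where
  "post_state \<A> U k =
     conj_by (apply_on (ws_dim \<A>) (meas_sub \<A>) (meas_ops \<A> ! k)) (final_state \<A> U)"

definition outcome_prob :: "query_algorithm \<Rightarrow> complex mat \<Rightarrow> nat \<Rightarrow> real" where
  "outcome_prob \<A> U k = Re (mtrace (post_state \<A> U k))"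

definition output_state :: "query_algorithm \<Rightarrow> complex mat \<Rightarrow> nat \<Rightarrow> complex mat" where
  "output_state \<A> U k =
     complex_of_real (1 / outcome_prob \<A> U k) \<cdot>\<^sub>m reduced_state (out_sub \<A>) (post_state \<A> U k)"

text \<open>Outcomes of probability zero, for which \<^const>\<open>output_state\<close> is a dummy value,
  contribute nothing to the sum.\<close>

definition success_prob :: "query_algorithm \<Rightarrow> complex mat \<Rightarrow> (complex mat \<Rightarrow> bool) \<Rightarrow> real" where
  "success_prob \<A> U P =
     (\<Sum>k | k < length (meas_ops \<A>) \<and> P (output_state \<A> U k). outcome_prob \<A> U k)"

definition prepares_ground_states ::
  "real \<Rightarrow> nat \<Rightarrow> nat \<Rightarrow> real \<Rightarrow> real \<Rightarrow> query_algorithm \<Rightarrow> bool" where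
  "prepares_ground_states \<alpha> a d \<Delta> p \<A> \<longleftrightarrow>
     (\<forall>z<d. \<forall>U. block_encoding \<alpha> a d U (search_hamiltonian d \<Delta> z) \<longrightarrow>
        p \<le> success_prob \<A> U (\<lambda>\<rho>. 3 / 4 \<le> Re (expval \<rho> (ket d z))))"

end

theory Submission
  imports Defs "HOL-Analysis.Convex"
begin

text \<open>
  A hybrid argument. With $s = \Delta/\alpha$, each $H_z$ has a self-adjoint block encoding
  $U_z$ that differs from a fixed unitary $U_0$, independent of $z$, by an operator supported on
  the two basis states carrying the label $z$ and of norm at most $\sqrt{2} s$. Let $W_z$ and
  $W_0$ be the total circuits run with $U_z$ and $U_0$. Since the query weights of the $W_0$ run
  on different labels add up to at most 1, each query contributes at most $\sqrt{2} s
  \sqrt{d}$ to $\sum_z \|W_z - W_0\|$ by Cauchy-Schwarz, where the norm is the one induced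
  by the initial state. The square root of the average overlap with $|z\rangle$ is a seminorm
  dominated by this norm; it is at least $\sqrt{3p/4}$ at $W_z$, and its values at $W_0$ sum to
  at most $\sqrt{d}$. Hence $d \sqrt{3p/4} \le \sqrt{d} + \sqrt{2} s \sqrt{d} Q$.
\<close>

subsection \<open>Matrices and traces\<close>

text \<open>The factor \<open>s\<close> per query depends on the choice of block encoding. With H =
  \<open>search_hamiltonian d \<Delta> z\<close>, it is the standard Hermitian dilation, with
  diagonal blocks H/\<alpha> and -H/\<alpha>, off-diagonal blocks sqrt(1 - H^2/\<alpha>^2), and the
  identity on the remaining ancilla values. Replacing H by 0 changes the diagonal blocks at first
  order in \<open>s\<close> and the off-diagonal ones only at second order. The promise on the
  algorithm does not cover H = 0; that run enters because its overlaps with the d basis states share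
  a total of 1 and so are small on average. A second obstacle is that the output state is normalised
  after the measurement and hence is not quadratic in the circuit. Weighting the overlap of each
  outcome by the probability of that outcome removes the denominator, and success with probability p
  at threshold 3/4 leaves a weighted overlap of at least 3p/4.\<close>

lemma mat_adjoint_dim [simp]:
  "dim_row (mat_adjoint A) = dim_col A" "dim_col (mat_adjoint A) = dim_row A"
  by (auto simp: mat_adjoint_def)

lemma mat_adjoint_carrier [simp]: "A \<in> carrier_mat m n \<Longrightarrow> mat_adjoint A \<in> carrier_mat n m"
  by (rule carrier_matI) auto

lemma mat_adjoint_index [simp]:
  fixes A :: "complex mat"
  assumes "i < dim_col A" "j < dim_row A"
  shows "mat_adjoint A $$ (i, j) = cnj (A $$ (j, i))"
  using assms by (simp add: mat_adjoint_def mat_of_rows_index)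

lemma mult_mat_index:
  assumes "A \<in> carrier_mat l m" "B \<in> carrier_mat m n" "i < l" "j < n"
  shows "(A * B) $$ (i, j) = (\<Sum>k<m. A $$ (i, k) * B $$ (k, j))"
  using assms by (auto simp: scalar_prod_def atLeast0LessThan intro!: sum.cong)

lemma mat_adjoint_mult:
  fixes A :: "complex mat"
  assumes "A \<in> carrier_mat l m" "B \<in> carrier_mat m n"
  shows "mat_adjoint (A * B) = mat_adjoint B * mat_adjoint A"
proof (rule eq_matI)
  fix i j assume "i < dim_row (mat_adjoint B * mat_adjoint A)" "j < dim_col (mat_adjoint B * mat_adjoint A)"
  then have ij: "i < n" "j < l" using assms by auto
  have "mat_adjoint (A * B) $$ (i, j) = cnj ((A * B) $$ (j, i))"
    using assms ij by (subst mat_adjoint_index) auto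
  also have "\<dots> = (\<Sum>k<m. cnj (B $$ (k, i)) * cnj (A $$ (j, k)))"
    by (simp add: mult_mat_index[OF assms ij(2,1)] mult.commute del: index_mult_mat(1))
  also have "\<dots> = (mat_adjoint B * mat_adjoint A) $$ (i, j)"
    using assms ij by (simp add: mult_mat_index[of _ n m _ l] del: index_mult_mat(1))
  finally show "mat_adjoint (A * B) $$ (i, j) = (mat_adjoint B * mat_adjoint A) $$ (i, j)" .
qed (use assms in auto)

lemma mtrace_mult_comm:
  assumes "A \<in> carrier_mat m n" "B \<in> carrier_mat n m"
  shows "mtrace (A * B) = mtrace (B * A)"
proof -
  have "mtrace (A * B) = (\<Sum>i<m. \<Sum>k<n. A $$ (i, k) * B $$ (k, i))"
    using assms unfolding mtrace_def
    by (auto intro!: sum.cong simp del: index_mult_mat(1) simp: mult_mat_index[OF assms])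
  also have "\<dots> = (\<Sum>k<n. \<Sum>i<m. B $$ (k, i) * A $$ (i, k))"
    by (subst sum.swap) (simp add: mult.commute)
  also have "\<dots> = mtrace (B * A)"
    using assms unfolding mtrace_def
    by (auto intro!: sum.cong simp del: index_mult_mat(1) simp: mult_mat_index[OF assms(2,1)])
  finally show ?thesis .
qed

lemma conj_by_carrier [simp]:
  "V \<in> carrier_mat m n \<Longrightarrow> \<rho> \<in> carrier_mat n n \<Longrightarrow> conj_by V \<rho> \<in> carrier_mat m m"
  by (auto simp: conj_by_def)

lemma conj_by_conj_by:
  assumes "V \<in> carrier_mat l m" "W \<in> carrier_mat m n" "\<rho> \<in> carrier_mat n n"
  shows "conj_by V (conj_by W \<rho>) = conj_by (V * W) \<rho>"
proof -
  have V': "mat_adjoint V \<in> carrier_mat m l" and W': "mat_adjoint W \<in> carrier_mat n m"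
    using assms by auto
  have "V * (W * \<rho> * mat_adjoint W) * mat_adjoint V
      = (V * (W * \<rho>)) * (mat_adjoint W * mat_adjoint V)"
    using assms V' W' assoc_mult_mat[of V l m "W * \<rho>" n "mat_adjoint W" m]
      assoc_mult_mat[of "V * (W * \<rho>)" l n "mat_adjoint W" m "mat_adjoint V" l] by simp
  then show ?thesis
    using assms by (simp add: conj_by_def mat_adjoint_mult[of V l m W n] assoc_mult_mat[of V l m W n \<rho> n])
qed

lemma mtrace_conj_by:
  assumes "V \<in> carrier_mat m n" "X \<in> carrier_mat n n"
  shows "mtrace (conj_by V X) = mtrace (mat_adjoint V * V * X)"
proof -
  have "mtrace (conj_by V X) = mtrace (mat_adjoint V * (V * X))"
    unfolding conj_by_def using assms by (subst mtrace_mult_comm[of _ m n]) auto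
  then show ?thesis using assms by (simp add: assoc_mult_mat[of _ n m V n])
qed

lemma mtrace_conj_by_unitary:
  assumes "is_unitary n V" "X \<in> carrier_mat n n"
  shows "mtrace (conj_by V X) = mtrace X"
  using assms by (subst mtrace_conj_by[of V n n]) (auto simp: is_unitary_def)

lemma conj_by_index:
  assumes "A \<in> carrier_mat m n" "\<rho> \<in> carrier_mat n n" "i < m" "j < m"
  shows "conj_by A \<rho> $$ (i, j) = (\<Sum>k<n. \<Sum>l<n. A $$ (i, k) * \<rho> $$ (k, l) * cnj (A $$ (j, l)))"
proof -
  have "conj_by A \<rho> $$ (i, j) = (\<Sum>l<n. (A * \<rho>) $$ (i, l) * cnj (A $$ (j, l)))"
    unfolding conj_by_def using assms
    by (subst mult_mat_index[of _ m n]) (auto intro!: sum.cong)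
  also have "\<dots> = (\<Sum>l<n. \<Sum>k<n. A $$ (i, k) * \<rho> $$ (k, l) * cnj (A $$ (j, l)))"
    using assms by (auto intro!: sum.cong simp del: index_mult_mat(1) simp: mult_mat_index[of _ m n] sum_distrib_right)
  finally show ?thesis by (subst sum.swap)
qed

lemma one_smult_mat: "(1 :: 'a :: monoid_mult) \<cdot>\<^sub>m A = A"
  by (rule eq_matI) auto

lemma expval_sum:
  assumes "A \<in> carrier_mat n n" "v \<in> carrier_vec n"
  shows "expval A v = (\<Sum>k<n. \<Sum>l<n. cnj (v $ k) * A $$ (k, l) * v $ l)"
proof -
  have "expval A v = (\<Sum>k<n. (\<Sum>l<n. A $$ (k, l) * v $ l) * cnj (v $ k))"
    using assms by (auto simp: expval_def scalar_prod_def atLeast0LessThan intro!: sum.cong)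
  then show ?thesis by (simp add: sum_distrib_left mult.commute mult.left_commute)
qed

text \<open>The diagonal entry is the expectation of \<open>\<rho>\<close> in the conjugated i-th
  row of \<open>A\<close>, so positivity of \<open>\<rho>\<close> applies directly, also for
  rectangular \<open>A\<close>.\<close>

lemma Re_conj_by_diag_nonneg:
  assumes "density_operator n \<rho>" "A \<in> carrier_mat m n" "i < m"
  shows "0 \<le> Re (conj_by A \<rho> $$ (i, i))"
proof -
  have \<rho>: "\<rho> \<in> carrier_mat n n" using assms(1) by (simp add: density_operator_def)
  define v where "v = vec n (\<lambda>k. cnj (A $$ (i, k)))"
  have "conj_by A \<rho> $$ (i, i) = expval \<rho> v"
    using assms \<rho> by (simp add: conj_by_index[of A m n] expval_sum[of \<rho> n] v_def)
  then show ?thesis using assms(1) by (simp add: density_operator_def v_def)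
qed

subsection \<open>Seminorms from quadratic forms\<close>

text \<open>
  Working with the quadratic forms $A \mapsto \mathrm{tr}(A \rho A^\dagger)$ on matrices avoids
  purifying the mixed initial state $\rho$. Quadratic behaviour along real lines is the only
  part of the inner product structure that the triangle inequality for $\sqrt{q}$ needs.
\<close>

definition psd_form :: "nat \<Rightarrow> (complex mat \<Rightarrow> real) \<Rightarrow> bool" where
  "psd_form n q \<longleftrightarrow> (\<forall>A\<in>carrier_mat n n. 0 \<le> q A) \<and>
     (\<forall>A\<in>carrier_mat n n. \<forall>B\<in>carrier_mat n n. \<exists>b. \<forall>t::real.
        q (A + complex_of_real t \<cdot>\<^sub>m B) = q A + 2 * b * t + q B * t\<^sup>2)"

lemma psd_formD_nonneg: "psd_form n q \<Longrightarrow> A \<in> carrier_mat n n \<Longrightarrow> 0 \<le> q A"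
  by (simp add: psd_form_def)

lemma psd_form_sum:
  assumes "\<And>i. i \<in> I \<Longrightarrow> psd_form n (f i)"
  shows "psd_form n (\<lambda>A. \<Sum>i\<in>I. f i A)"
proof -
  have "\<exists>b. \<forall>t. (\<Sum>i\<in>I. f i (A + complex_of_real t \<cdot>\<^sub>m B)) = (\<Sum>i\<in>I. f i A) + 2 * b * t + (\<Sum>i\<in>I. f i B) * t\<^sup>2"
    if AB: "A \<in> carrier_mat n n" "B \<in> carrier_mat n n" for A B
  proof -
    have "\<forall>i\<in>I. \<exists>b. \<forall>t. f i (A + complex_of_real t \<cdot>\<^sub>m B) = f i A + 2 * b * t + f i B * t\<^sup>2"
      using assms AB by (simp add: psd_form_def)
    then obtain b where "\<forall>i\<in>I. \<forall>t. f i (A + complex_of_real t \<cdot>\<^sub>m B) = f i A + 2 * b i * t + f i B * t\<^sup>2"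
      by metis
    then have "\<forall>t. (\<Sum>i\<in>I. f i (A + complex_of_real t \<cdot>\<^sub>m B)) = (\<Sum>i\<in>I. f i A) + 2 * (\<Sum>i\<in>I. b i) * t + (\<Sum>i\<in>I. f i B) * t\<^sup>2"
      by (simp add: sum.distrib sum_distrib_left sum_distrib_right)
    then show ?thesis by blast
  qed
  then show ?thesis using assms by (auto simp: psd_form_def intro!: sum_nonneg)
qed

text \<open>The core of Cauchy-Schwarz: evaluate the polynomial at its vertex
  \<open>- b / c\<close>. For c = 0, an affine function that is bounded below must be
  constant.\<close>

lemma quadratic_nonneg_discrim:
  fixes a b c :: real
  assumes c: "0 \<le> c" and nonneg: "\<And>t. 0 \<le> a + 2 * b * t + c * t\<^sup>2"
  shows "b\<^sup>2 \<le> a * c"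
proof (cases "c = 0")
  case True
  have "b = 0"
  proof (rule ccontr)
    assume "b \<noteq> 0"
    \<comment> \<open>At this point the affine function takes the value -1.\<close>
    then show False using nonneg[of "- (a + 1) / (2 * b)"] True by simp
  qed
  then show ?thesis using True by simp
next
  case False
  define t where "t = - b / c"
  have t: "c * t = - b" using False by (simp add: t_def)
  have "0 \<le> c * (a + 2 * b * t + c * t\<^sup>2)"
    by (intro mult_nonneg_nonneg c nonneg)
  also have "\<dots> = a * c + 2 * b * (c * t) + (c * t)\<^sup>2"
    by (simp only: power2_eq_square distrib_left mult_ac)
  finally show ?thesis unfolding t by (simp add: power2_eq_square)
qed

text \<open>The linear coefficient \<open>b\<close> plays the part of the real inner product of
  \<open>A\<close> and \<open>B\<close>. The discriminant bounds it by
  \<open>sqrt (q A * q B)\<close>, and t = 1 evaluates the form at the sum.\<close>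

lemma psd_form_triangle:
  assumes q: "psd_form n q" and AB: "A \<in> carrier_mat n n" "B \<in> carrier_mat n n"
  shows "sqrt (q (A + B)) \<le> sqrt (q A) + sqrt (q B)"
proof -
  obtain b where b: "\<And>t. q (A + complex_of_real t \<cdot>\<^sub>m B) = q A + 2 * b * t + q B * t\<^sup>2"
    using q AB unfolding psd_form_def by blast
  have nn: "0 \<le> q A" "0 \<le> q B" "0 \<le> q (A + complex_of_real t \<cdot>\<^sub>m B)" for t
    using q AB by (auto simp: psd_form_def)
  have "b\<^sup>2 \<le> q A * q B"
    by (rule quadratic_nonneg_discrim[OF nn(2)]) (simp only: b[symmetric] nn(3))
  then have "b \<le> sqrt (q A * q B)" by (rule real_le_rsqrt)
  moreover have "q (A + B) = q A + 2 * b + q B"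
    using b[of 1] AB by (simp add: one_smult_mat)
  ultimately have "q (A + B) \<le> (sqrt (q A) + sqrt (q B))\<^sup>2"
    using nn by (simp add: power2_sum real_sqrt_mult)
  then show ?thesis using nn by (intro real_le_lsqrt) auto
qed

text \<open>The entry is a sesquilinear form in row i of \<open>K * A\<close>, which is linear in
  \<open>A\<close>. The prefactor \<open>K\<close> leaves room for a measurement operator, or for
  the identity when the form is summed to a trace.\<close>

lemma psd_form_conj_by_diag:
  assumes \<rho>: "density_operator n \<rho>" and K: "K \<in> carrier_mat n n" and i: "i < n"
  shows "psd_form n (\<lambda>A. Re (conj_by (K * A) \<rho> $$ (i, i)))"
  unfolding psd_form_def
proof (intro conjI ballI)
  fix A :: "complex mat" assume A: "A \<in> carrier_mat n n"
  show "0 \<le> Re (conj_by (K * A) \<rho> $$ (i, i))"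
    using Re_conj_by_diag_nonneg[OF \<rho> _ i] A K by auto
next
  fix A B :: "complex mat" assume A: "A \<in> carrier_mat n n" and B: "B \<in> carrier_mat n n"
  have C\<rho>: "\<rho> \<in> carrier_mat n n" using \<rho> by (simp add: density_operator_def)
  define x where "x k = (K * A) $$ (i, k)" for k
  define y where "y k = (K * B) $$ (i, k)" for k
  \<comment> \<open>Half the real part of both cross terms, so that the coefficient of t becomes
    2b.\<close>
  define b where "b = Re (\<Sum>k<n. \<Sum>l<n. x k * \<rho> $$ (k, l) * cnj (y l) + y k * \<rho> $$ (k, l) * cnj (x l)) / 2"
  have KA: "K * A \<in> carrier_mat n n" and KB: "K * B \<in> carrier_mat n n" using A B K by auto
  have "Re (conj_by (K * (A + complex_of_real t \<cdot>\<^sub>m B)) \<rho> $$ (i, i)) =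
     Re (conj_by (K * A) \<rho> $$ (i, i)) + 2 * b * t + Re (conj_by (K * B) \<rho> $$ (i, i)) * t\<^sup>2" for t
  proof -
    have "K * (A + complex_of_real t \<cdot>\<^sub>m B) = K * A + complex_of_real t \<cdot>\<^sub>m (K * B)"
      using A B K by (simp add: mult_add_distrib_mat[of K n n] mult_smult_distrib[of K n n])
    moreover have "conj_by (K * A + complex_of_real t \<cdot>\<^sub>m (K * B)) \<rho> $$ (i, i)
       = (\<Sum>k<n. \<Sum>l<n. (x k + of_real t * y k) * \<rho> $$ (k, l) * cnj (x l + of_real t * y l))"
    proof -
      have *: "(K * A + complex_of_real t \<cdot>\<^sub>m (K * B)) $$ (i, k) = x k + of_real t * y k" if "k < n" for k
        using carrier_matD[OF KA] carrier_matD[OF KB] i that by (simp add: x_def y_def del: index_mult_mat)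
      have "K * A + complex_of_real t \<cdot>\<^sub>m (K * B) \<in> carrier_mat n n" using KA KB by simp
      from conj_by_index[OF this C\<rho> i i] show ?thesis
        by (simp add: * del: index_add_mat index_smult_mat index_mult_mat)
    qed
    also have "\<dots> = (\<Sum>k<n. \<Sum>l<n. x k * \<rho> $$ (k, l) * cnj (x l))
        + of_real t * (\<Sum>k<n. \<Sum>l<n. x k * \<rho> $$ (k, l) * cnj (y l) + y k * \<rho> $$ (k, l) * cnj (x l))
        + of_real (t\<^sup>2) * (\<Sum>k<n. \<Sum>l<n. y k * \<rho> $$ (k, l) * cnj (y l))"
    proof -
      have "(\<Sum>k<n. \<Sum>l<n. f k l + u * g k l + v * h k l) =
        (\<Sum>k<n. \<Sum>l<n. f k l) + u * (\<Sum>k<n. \<Sum>l<n. g k l) + v * (\<Sum>k<n. \<Sum>l<n. h k l)"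
        for u v :: complex and f g h
        by (simp add: sum.distrib sum_distrib_left)
      moreover have "(x k + of_real t * y k) * r * cnj (x l + of_real t * y l) =
        x k * r * cnj (x l) + of_real t * (x k * r * cnj (y l) + y k * r * cnj (x l))
        + of_real (t\<^sup>2) * (y k * r * cnj (y l))" for r k l
        by (simp add: algebra_simps power2_eq_square)
      ultimately show ?thesis by (simp only:)
    qed
    finally show ?thesis
      using conj_by_index[OF KA C\<rho> i i] conj_by_index[OF KB C\<rho> i i]
      by (simp add: x_def y_def b_def)
  qed
  then show "\<exists>b. \<forall>t. Re (conj_by (K * (A + complex_of_real t \<cdot>\<^sub>m B)) \<rho> $$ (i, i)) =
     Re (conj_by (K * A) \<rho> $$ (i, i)) + 2 * b * t + Re (conj_by (K * B) \<rho> $$ (i, i)) * t\<^sup>2" by blast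
qed

subsection \<open>Operators on subsystems\<close>

lemma sub_coords_bij:
  "is_subsystem N S \<Longrightarrow> bij_betw (sub_coords S) {..<N} ({..<sub_dim S} \<times> {..<env_dim S})"
  unfolding is_subsystem_def sub_coords_def by (rule bij_betw_inv_into)

lemma sub_index_less:
  assumes "is_subsystem N S" "x < sub_dim S" "r < env_dim S"
  shows "sub_index S x r < N"
  using bij_betwE[OF assms(1)[unfolded is_subsystem_def]] assms(2,3) by force

lemma sub_coords_range:
  assumes "is_subsystem N S" "i < N"
  shows "fst (sub_coords S i) < sub_dim S" "snd (sub_coords S i) < env_dim S"
  using bij_betwE[OF sub_coords_bij[OF assms(1)]] assms(2) by (auto simp: mem_Times_iff)

lemma sub_coords_eq_iff:
  assumes "is_subsystem N S" "i < N" "j < N"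
  shows "sub_coords S i = sub_coords S j \<longleftrightarrow> i = j"
  using sub_coords_bij[OF assms(1)] assms(2,3) by (auto simp: bij_betw_def inj_on_def)

lemma sum_sub_coords:
  assumes "is_subsystem N S"
  shows "(\<Sum>i<N. f (sub_coords S i)) = (\<Sum>x<sub_dim S. \<Sum>r<env_dim S. f (x, r))"
proof -
  have "(\<Sum>i<N. f (sub_coords S i)) = (\<Sum>xr\<in>{..<sub_dim S} \<times> {..<env_dim S}. f xr)"
    by (rule sum.reindex_bij_betw[OF sub_coords_bij[OF assms]])
  then show ?thesis by (simp add: sum.cartesian_product)
qed

lemma apply_on_carrier [simp]: "apply_on N S A \<in> carrier_mat N N"
  by (simp add: apply_on_def)

lemma apply_on_index:
  assumes "i < N" "j < N"
  shows "apply_on N S A $$ (i, j) =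
    (if snd (sub_coords S i) = snd (sub_coords S j)
     then A $$ (fst (sub_coords S i), fst (sub_coords S j)) else 0)"
  using assms by (simp add: apply_on_def case_prod_unfold)

lemma apply_on_mult:
  assumes S: "is_subsystem N S"
    and A: "A \<in> carrier_mat (sub_dim S) (sub_dim S)" and B: "B \<in> carrier_mat (sub_dim S) (sub_dim S)"
  shows "apply_on N S A * apply_on N S B = apply_on N S (A * B)"
proof (rule eq_matI)
  fix i j assume "i < dim_row (apply_on N S (A * B))" "j < dim_col (apply_on N S (A * B))"
  then have ij: "i < N" "j < N" by (auto simp: apply_on_def)
  define x r y s where "x = fst (sub_coords S i)" and "r = snd (sub_coords S i)"
    and "y = fst (sub_coords S j)" and "s = snd (sub_coords S j)"
  have xy: "x < sub_dim S" "y < sub_dim S" and rs: "r < env_dim S" "s < env_dim S"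
    using sub_coords_range[OF S] ij by (auto simp: x_def y_def r_def s_def)
  \<comment> \<open>Written as a function of the coordinates of \<open>l\<close>, the summand can be
    summed over subsystem and environment labels separately; the environment sum then collapses to t
    = r.\<close>
  have "(apply_on N S A * apply_on N S B) $$ (i, j) =
      (\<Sum>l<N. (\<lambda>(w, t). (if r = t then A $$ (x, w) else 0) * (if t = s then B $$ (w, y) else 0)) (sub_coords S l))"
    using ij by (subst mult_mat_index[of _ N N _ N])
      (auto simp: apply_on_index x_def y_def r_def s_def case_prod_unfold intro!: sum.cong)
  also have "\<dots> = (\<Sum>w<sub_dim S. \<Sum>t<env_dim S. if t = r then (if r = s then A $$ (x, w) * B $$ (w, y) else 0) else 0)"
    by (subst sum_sub_coords[OF S]) (intro sum.cong refl, auto)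
  also have "\<dots> = (if r = s then (A * B) $$ (x, y) else 0)"
    using rs xy by (simp add: mult_mat_index[OF A B] del: index_mult_mat(1))
  finally show "(apply_on N S A * apply_on N S B) $$ (i, j) = apply_on N S (A * B) $$ (i, j)"
    using ij by (simp add: apply_on_index x_def y_def r_def s_def del: index_mult_mat(1))
qed (auto simp: apply_on_def)

lemma apply_on_one:
  assumes S: "is_subsystem N S"
  shows "apply_on N S (1\<^sub>m (sub_dim S)) = 1\<^sub>m N"
proof (rule eq_matI)
  fix i j assume "i < dim_row (1\<^sub>m N)" "j < dim_col (1\<^sub>m N)"
  then show "apply_on N S (1\<^sub>m (sub_dim S)) $$ (i, j) = 1\<^sub>m N $$ (i, j)"
    using sub_coords_range[OF S] sub_coords_eq_iff[OF S, of i j]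
    by (auto simp: apply_on_index prod_eq_iff)
qed (auto simp: apply_on_def)

lemma apply_on_add:
  assumes S: "is_subsystem N S" and "A \<in> carrier_mat (sub_dim S) (sub_dim S)"
    and "B \<in> carrier_mat (sub_dim S) (sub_dim S)"
  shows "apply_on N S (A + B) = apply_on N S A + apply_on N S B"
  by (rule eq_matI) (use assms(2,3) sub_coords_range[OF S] in \<open>auto simp: apply_on_def case_prod_unfold\<close>)

lemma apply_on_adjoint:
  assumes S: "is_subsystem N S" and "A \<in> carrier_mat (sub_dim S) (sub_dim S)"
  shows "mat_adjoint (apply_on N S A) = apply_on N S (mat_adjoint A)"
proof (rule eq_matI)
  fix i j assume "i < dim_row (apply_on N S (mat_adjoint A))" "j < dim_col (apply_on N S (mat_adjoint A))"
  then have "i < N" "j < N" by (auto simp: apply_on_def)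
  then show "mat_adjoint (apply_on N S A) $$ (i, j) = apply_on N S (mat_adjoint A) $$ (i, j)"
    using assms(2) sub_coords_range[OF S]
    by (subst mat_adjoint_index) (auto simp: apply_on_index, auto simp: apply_on_def)
qed (auto simp: apply_on_def)

lemma apply_on_unitary:
  assumes S: "is_subsystem N S" and U: "is_unitary (sub_dim S) U"
  shows "is_unitary N (apply_on N S U)"
  using U by (auto simp: is_unitary_def apply_on_adjoint[OF S] apply_on_mult[OF S] apply_on_one[OF S])

section \<open>Traces against diagonal operators and completeness of measurements\<close>

lemma mtrace_mult_diag:
  assumes "X \<in> carrier_mat n n" "D \<in> carrier_mat n n"
    and "\<And>i j. i < n \<Longrightarrow> j < n \<Longrightarrow> i \<noteq> j \<Longrightarrow> D $$ (i, j) = 0"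
  shows "mtrace (D * X) = (\<Sum>i<n. D $$ (i, i) * X $$ (i, i))"
proof -
  have "mtrace (D * X) = (\<Sum>i<n. (D * X) $$ (i, i))"
    using assms by (auto simp: mtrace_def intro!: sum.cong)
  also have "\<dots> = (\<Sum>i<n. D $$ (i, i) * X $$ (i, i))"
  proof (rule sum.cong[OF refl])
    fix i assume "i \<in> {..<n}"
    then have "(D * X) $$ (i, i) = (\<Sum>k<n. if k = i then D $$ (i, i) * X $$ (i, i) else 0)"
      using assms by (subst mult_mat_index[of _ n n]) (auto intro!: sum.cong simp del: sum.delta sum.delta')
    then show "(D * X) $$ (i, i) = D $$ (i, i) * X $$ (i, i)" using \<open>i \<in> {..<n}\<close> by simp
  qed
  finally show ?thesis .
qed

text \<open>Meant for the square of an error operator: once it is diagonal on the subsystem, it sees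
  only the populations of the state in the computational basis.\<close>

lemma mtrace_apply_on_diag:
  assumes S: "is_subsystem N S" and X: "X \<in> carrier_mat N N"
    and diag: "\<And>x y. x < sub_dim S \<Longrightarrow> y < sub_dim S \<Longrightarrow> x \<noteq> y \<Longrightarrow> D $$ (x, y) = 0"
  shows "mtrace (apply_on N S D * X) =
    (\<Sum>i<N. D $$ (fst (sub_coords S i), fst (sub_coords S i)) * X $$ (i, i))"
proof -
  have "apply_on N S D $$ (i, j) = 0" if "i < N" "j < N" "i \<noteq> j" for i j
    using that sub_coords_range[OF S] sub_coords_eq_iff[OF S that(1,2)] diag
    by (auto simp: apply_on_index prod_eq_iff)
  then have "mtrace (apply_on N S D * X) = (\<Sum>i<N. apply_on N S D $$ (i, i) * X $$ (i, i))"
    using X by (intro mtrace_mult_diag) auto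
  then show ?thesis by (simp add: apply_on_index)
qed

text \<open>Cyclicity of the trace turns each outcome into a trace against
  \<open>mat_adjoint M * M\<close>, and these effects sum to the identity.\<close>

lemma measurement_mtrace:
  assumes S: "is_subsystem N S" and X: "X \<in> carrier_mat N N"
    and Ms: "measurement (sub_dim S) Ms"
  shows "(\<Sum>k<length Ms. mtrace (conj_by (apply_on N S (Ms ! k)) X)) = mtrace X"
proof -
  let ?n = "sub_dim S"
  have add: "mtrace ((A + B) * X) = mtrace (A * X) + mtrace (B * X)"
    if "A \<in> carrier_mat N N" "B \<in> carrier_mat N N" for A B
    using that X by (simp add: add_mult_distrib_mat[of A N N B X N] mtrace_def sum.distrib)
  have C: "foldr (\<lambda>M S. mat_adjoint M * M + S) Ns (0\<^sub>m ?n ?n) \<in> carrier_mat ?n ?n"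
    if "set Ns \<subseteq> carrier_mat ?n ?n" for Ns :: "complex mat list"
    using that by (induction Ns) auto
  \<comment> \<open>Completeness is not inherited by the tail of a list, so the induction is over
    arbitrary lists and keeps the partial sum of effects on the right.\<close>
  have "(\<Sum>M\<leftarrow>Ns. mtrace (conj_by (apply_on N S M) X)) =
      mtrace (apply_on N S (foldr (\<lambda>M S. mat_adjoint M * M + S) Ns (0\<^sub>m ?n ?n)) * X)"
    if "set Ns \<subseteq> carrier_mat ?n ?n" for Ns
    using that
  proof (induction Ns)
    case Nil
    have "apply_on N S (0\<^sub>m ?n ?n) = (0\<^sub>m N N :: complex mat)"
      by (rule eq_matI) (use sub_coords_range[OF S] in \<open>auto simp: apply_on_def case_prod_unfold\<close>)
    then show ?case using X by (simp add: mtrace_def)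
  next
    case (Cons M Ns)
    have M: "M \<in> carrier_mat ?n ?n" and Ns: "set Ns \<subseteq> carrier_mat ?n ?n" using Cons.prems by auto
    have M2: "mat_adjoint M * M \<in> carrier_mat ?n ?n" using M by auto
    have "mtrace (conj_by (apply_on N S M) X) = mtrace (apply_on N S (mat_adjoint M * M) * X)"
      using M X by (simp add: mtrace_conj_by[of _ N N] apply_on_adjoint[OF S] apply_on_mult[OF S])
    then show ?case
      using Cons.IH[OF Ns] apply_on_add[OF S M2 C[OF Ns]] by (simp add: add)
  qed
  from this[of Ms] show ?thesis
    using Ms X by (simp add: measurement_def apply_on_one[OF S] sum_list_sum_nth atLeast0LessThan)
qed

subsection \<open>Block encodings of the search Hamiltonians\<close>

text \<open>
  The query unitaries and their differences only couple the basis states with ancilla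
  value 0 and 1; \<open>swap_idx d\<close> exchanges these two.
\<close>

definition swap_idx :: "nat \<Rightarrow> nat \<Rightarrow> nat" where
  "swap_idx d i = (if i < d then i + d else if i < 2 * d then i - d else i)"

text \<open>The order of the cases matters: at a fixed point of \<open>swap_idx d\<close> the
  diagonal value \<open>f i\<close> wins and \<open>g i\<close> does not appear.\<close>

definition swap_mat :: "nat \<Rightarrow> nat \<Rightarrow> (nat \<Rightarrow> real) \<Rightarrow> (nat \<Rightarrow> real) \<Rightarrow> complex mat" where
  "swap_mat n d f g = mat n n (\<lambda>(i, j). complex_of_real
     (if j = i then f i else if j = swap_idx d i then g i else 0))"

lemma swap_idx_less: "2 * d \<le> n \<Longrightarrow> i < n \<Longrightarrow> swap_idx d i < n"
  by (auto simp: swap_idx_def)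

lemma swap_idx_swap_idx [simp]: "swap_idx d (swap_idx d i) = i"
  by (auto simp: swap_idx_def)

lemma swap_idx_eq_iff: "swap_idx d i = j \<longleftrightarrow> i = swap_idx d j"
  by auto

lemma swap_mat_carrier [simp]: "swap_mat n d f g \<in> carrier_mat n n"
  by (simp add: swap_mat_def)

text \<open>Since \<open>swap_idx d\<close> is an involution, the only intermediate indices are
  \<open>i\<close> and its partner, so this family is closed under products. At a fixed point the
  two coincide, and the conditional prevents counting that index twice.\<close>

lemma swap_mat_mult:
  assumes "2 * d \<le> n"
  shows "swap_mat n d f g * swap_mat n d f' g' =
    swap_mat n d
      (\<lambda>i. f i * f' i + (if swap_idx d i = i then 0 else g i * g' (swap_idx d i)))
      (\<lambda>i. f i * g' i + g i * f' (swap_idx d i))"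
proof (rule eq_matI; (unfold swap_mat_def dim_row_mat dim_col_mat)?)
  fix i j assume ij: "i < n" "j < n"
  let ?s = "swap_idx d"
  have s: "?s i < n" using assms ij by (simp add: swap_idx_less)
  let ?A = "\<lambda>i j. if j = i then f i else if j = ?s i then g i else 0"
  let ?B = "\<lambda>i j. if j = i then f' i else if j = ?s i then g' i else 0"
  have "(\<Sum>k<n. ?A i k * ?B k j) = (\<Sum>k\<in>{i, ?s i}. ?A i k * ?B k j)"
    using ij s by (intro sum.mono_neutral_right) auto
  also have "\<dots> = (if j = i then f i * f' i + (if ?s i = i then 0 else g i * g' (?s i))
      else if j = ?s i then f i * g' i + g i * f' (?s i) else 0)"
    by (cases "?s i = i") (auto simp: swap_idx_eq_iff)
  finally have sum: "(\<Sum>k<n. ?A i k * ?B k j) = \<dots>" .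
  have "(mat n n (\<lambda>(i, j). complex_of_real (?A i j)) * mat n n (\<lambda>(i, j). complex_of_real (?B i j))) $$ (i, j)
     = complex_of_real (\<Sum>k<n. ?A i k * ?B k j)"
    using ij by (subst mult_mat_index[of _ n n _ n]) (auto simp del: of_real_mult simp: of_real_mult[symmetric] intro!: sum.cong)
  then show "(mat n n (\<lambda>(i, j). complex_of_real (?A i j)) * mat n n (\<lambda>(i, j). complex_of_real (?B i j))) $$ (i, j)
     = mat n n (\<lambda>(i, j). complex_of_real (if j = i then f i * f' i + (if ?s i = i then 0 else g i * g' (?s i))
      else if j = ?s i then f i * g' i + g i * f' (?s i) else 0)) $$ (i, j)"
    using ij unfolding sum by simp
qed auto

lemma swap_mat_adjoint:
  assumes "\<And>i. g (swap_idx d i) = g i"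
  shows "mat_adjoint (swap_mat n d f g) = swap_mat n d f g"
  by (rule eq_matI) (auto simp: swap_mat_def assms swap_idx_eq_iff)

lemma swap_mat_cong:
  assumes "\<And>i. i < n \<Longrightarrow> f i = f' i" "\<And>i. i < n \<Longrightarrow> swap_idx d i \<noteq> i \<Longrightarrow> g i = g' i"
  shows "swap_mat n d f g = swap_mat n d f' g'"
  by (rule eq_matI) (use assms in \<open>auto simp: swap_mat_def\<close>)

lemma is_unitary_mult:
  assumes "is_unitary n U" "is_unitary n V"
  shows "is_unitary n (U * V)"
proof -
  have C: "U \<in> carrier_mat n n" "V \<in> carrier_mat n n" "mat_adjoint U \<in> carrier_mat n n" "mat_adjoint V \<in> carrier_mat n n"
    using assms by (auto simp: is_unitary_def)
  have "mat_adjoint U * (U * V) = V" "V * (mat_adjoint V * mat_adjoint U) = mat_adjoint U"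
    using assms C assoc_mult_mat[OF C(3,1,2)] assoc_mult_mat[OF C(2,4,3)] by (simp_all add: is_unitary_def)
  moreover have "mat_adjoint V * mat_adjoint U * (U * V) = mat_adjoint V * (mat_adjoint U * (U * V))"
    "U * V * (mat_adjoint V * mat_adjoint U) = U * (V * (mat_adjoint V * mat_adjoint U))"
    using C by (intro assoc_mult_mat; auto)+
  ultimately show ?thesis
    using assms C by (simp add: is_unitary_def mat_adjoint_mult[of U n n V n])
qed

text \<open>
  On the span of $|0\rangle|z\rangle$ and $|1\rangle|z\rangle$ this is the reflection with matrix
  rows $(-s, \sqrt{1-s^2})$ and $(\sqrt{1-s^2}, s)$; elsewhere it just exchanges ancilla values 0
  and 1. It is self-adjoint, so both query types act alike, and it is within
  $\sqrt{2} s$ of \<open>blank_unitary\<close>, which block-encodes 0.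
\<close>

definition search_unitary :: "nat \<Rightarrow> nat \<Rightarrow> real \<Rightarrow> nat \<Rightarrow> complex mat" where
  "search_unitary n d s z = swap_mat n d
     (\<lambda>i. if i = z then - s else if i = z + d then s else if i < 2 * d then 0 else 1)
     (\<lambda>i. if i = z \<or> i = z + d then sqrt (1 - s\<^sup>2) else 1)"

definition blank_unitary :: "nat \<Rightarrow> nat \<Rightarrow> complex mat" where
  "blank_unitary n d = swap_mat n d (\<lambda>i. if i < 2 * d then 0 else 1) (\<lambda>_. 1)"

definition search_diff :: "nat \<Rightarrow> nat \<Rightarrow> real \<Rightarrow> nat \<Rightarrow> complex mat" where
  "search_diff n d s z = swap_mat n d
     (\<lambda>i. if i = z then - s else if i = z + d then s else 0)
     (\<lambda>i. if i = z \<or> i = z + d then sqrt (1 - s\<^sup>2) - 1 else 0)"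

lemma search_carrier [simp]:
  "search_unitary n d s z \<in> carrier_mat n n" "blank_unitary n d \<in> carrier_mat n n"
  "search_diff n d s z \<in> carrier_mat n n"
  by (simp_all add: search_unitary_def blank_unitary_def search_diff_def)

lemma swap_idx_marked:
  assumes "z < d"
  shows "swap_idx d i = z \<longleftrightarrow> i = z + d" "swap_idx d i = z + d \<longleftrightarrow> i = z"
  using assms by (auto simp: swap_idx_def)

lemma search_unitary_adjoint:
  "z < d \<Longrightarrow> mat_adjoint (search_unitary n d s z) = search_unitary n d s z"
  unfolding search_unitary_def by (rule swap_mat_adjoint) (auto simp: swap_idx_marked)

lemma search_diff_adjoint:
  "z < d \<Longrightarrow> mat_adjoint (search_diff n d s z) = search_diff n d s z"
  unfolding search_diff_def by (rule swap_mat_adjoint) (auto simp: swap_idx_marked)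

lemma blank_unitary_adjoint: "mat_adjoint (blank_unitary n d) = blank_unitary n d"
  unfolding blank_unitary_def by (rule swap_mat_adjoint) simp

lemma swap_mat_one: "swap_mat n d (\<lambda>_. 1) (\<lambda>_. 0) = 1\<^sub>m n"
  by (rule eq_matI) (auto simp: swap_mat_def)

lemma swap_idx_fixed: "swap_idx d i = i \<longleftrightarrow> d = 0 \<or> 2 * d \<le> i"
  by (auto simp: swap_idx_def)

lemma swap_idx_less_double: "swap_idx d i < 2 * d \<longleftrightarrow> i < 2 * d"
  by (auto simp: swap_idx_def)

lemma search_unitary_square:
  assumes "z < d" "2 * d \<le> n" "s\<^sup>2 \<le> 1"
  shows "search_unitary n d s z * search_unitary n d s z = 1\<^sub>m n"
  unfolding search_unitary_def swap_mat_mult[OF assms(2)] swap_mat_one[symmetric, of n d]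
  by (rule swap_mat_cong)
    (use assms in \<open>auto simp: swap_idx_marked swap_idx_fixed swap_idx_less_double power2_eq_square[symmetric]\<close>)

lemma blank_unitary_square:
  assumes "2 * d \<le> n"
  shows "blank_unitary n d * blank_unitary n d = 1\<^sub>m n"
  unfolding blank_unitary_def swap_mat_mult[OF assms] swap_mat_one[symmetric, of n d]
  by (rule swap_mat_cong) (auto simp: swap_idx_fixed swap_idx_less_double)

text \<open>On the marked pair the error is a real symmetric 2 by 2 matrix of trace zero, so its
  square is a scalar, namely s^2 + (1 - c)^2 = 2 - 2c with c = sqrt(1 - s^2).\<close>

lemma search_diff_square:
  assumes "z < d" "2 * d \<le> n" "s\<^sup>2 \<le> 1"
  shows "search_diff n d s z * search_diff n d s z =
    swap_mat n d (\<lambda>i. if i = z \<or> i = z + d then 2 - 2 * sqrt (1 - s\<^sup>2) else 0) (\<lambda>_. 0)"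
proof -
  define c where "c = sqrt (1 - s\<^sup>2)"
  have "c * c = 1 - s * s" using assms(3) by (simp add: c_def flip: power2_eq_square)
  then have "s * s + (c - 1) * (c - 1) = 2 - 2 * c" by (simp add: algebra_simps)
  then show ?thesis
    unfolding search_diff_def swap_mat_mult[OF assms(2)] c_def[symmetric]
    by (intro swap_mat_cong) (use assms in \<open>auto simp: swap_idx_marked swap_idx_fixed mult.commute\<close>)
qed

lemma search_unitary_decomp:
  assumes "z < d"
  shows "search_unitary n d s z = blank_unitary n d + search_diff n d s z"
  by (rule eq_matI) (use assms in \<open>auto simp: search_unitary_def blank_unitary_def search_diff_def swap_mat_def\<close>)

lemma search_unitary_unitary:
  assumes "z < d" "2 * d \<le> n" "s\<^sup>2 \<le> 1"
  shows "is_unitary n (search_unitary n d s z)"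
  using assms by (simp add: is_unitary_def search_unitary_adjoint search_unitary_square)

lemma blank_unitary_unitary: "2 * d \<le> n \<Longrightarrow> is_unitary n (blank_unitary n d)"
  by (simp add: is_unitary_def blank_unitary_adjoint blank_unitary_square)

section \<open>Compression of a unitary to ancilla value 0\<close>

lemma kron_pow_ket0:
  "kron_pow (mat_of_cols 2 [ket 2 0]) a = mat (2 ^ a) 1 (\<lambda>(i, j). if i = 0 then 1 else 0)"
proof (induction a)
  case 0
  show ?case by (rule eq_matI) auto
next
  case (Suc a)
  have "i div 2 ^ a < 2" if "i < 2 * 2 ^ a" for i :: nat
    using that by (simp add: less_mult_imp_div_less)
  moreover have "i div 2 ^ a = 0 \<and> i mod 2 ^ a = 0 \<longleftrightarrow> i = 0" for i :: nat
    by (metis div_0 mod_0 mult_div_mod_eq mult_0_right add_0)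
  moreover have "mat_of_cols 2 [ket 2 0] = mat 2 1 (\<lambda>(i, j). if i = 0 then 1 else 0 :: complex)"
    by (rule eq_matI) (auto simp: mat_of_cols_def)
  ultimately show ?case
    unfolding kron_pow.simps Suc kron_def by (intro eq_matI) auto
qed

text \<open>With index b d + x, ancilla value 0 occupies the first d indices. The isometry is
  therefore the plain inclusion, and compressing with it reads off the leading d by d block.\<close>

lemma ancilla_isometry_eq:
  "ancilla_isometry a d = mat (2 ^ a * d) d (\<lambda>(i, j). if i = j then 1 else 0)"
proof (rule eq_matI)
  fix i j assume "i < dim_row (mat (2 ^ a * d) d (\<lambda>(i, j). if i = j then 1 else 0 :: complex))"
    "j < dim_col (mat (2 ^ a * d) d (\<lambda>(i, j). if i = j then 1 else 0 :: complex))"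
  then have ij: "i < 2 ^ a * d" "j < d" by auto
  then have "i div d < 2 ^ a" by (simp add: less_mult_imp_div_less)
  moreover have "i div d = 0 \<and> i mod d = j \<longleftrightarrow> i = j"
    using ij by (auto simp: div_eq_0_iff)
  ultimately show "ancilla_isometry a d $$ (i, j) = mat (2 ^ a * d) d (\<lambda>(i, j). if i = j then 1 else 0) $$ (i, j)"
    using ij by (auto simp: ancilla_isometry_def kron_pow_ket0 kron_def)
qed (auto simp: ancilla_isometry_def kron_pow_ket0 kron_def)

lemma ancilla_block:
  assumes U: "U \<in> carrier_mat (2 ^ a * d) (2 ^ a * d)"
  shows "mat_adjoint (ancilla_isometry a d) * U * ancilla_isometry a d = mat d d (\<lambda>(i, j). U $$ (i, j))"
proof (rule eq_matI)
  let ?n = "2 ^ a * d" and ?J = "ancilla_isometry a d"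
  have J: "?J \<in> carrier_mat ?n d" by (simp add: ancilla_isometry_eq)
  have J': "mat_adjoint ?J \<in> carrier_mat d ?n" using J by simp
  have le: "d \<le> ?n" by simp
  fix i j assume "i < dim_row (mat d d (\<lambda>(i, j). U $$ (i, j)))" "j < dim_col (mat d d (\<lambda>(i, j). U $$ (i, j)))"
  then have ij: "i < d" "j < d" by auto
  have row: "(mat_adjoint ?J * U) $$ (i, l) = U $$ (i, l)" if "l < ?n" for l
  proof -
    have "(mat_adjoint ?J * U) $$ (i, l) = (\<Sum>k<?n. if k = i then U $$ (i, l) else 0)"
      using J ij that le by (subst mult_mat_index[OF J' U]) (auto simp: ancilla_isometry_eq intro!: sum.cong simp del: sum.delta sum.delta')
    then show ?thesis using ij le by simp
  qed
  have "(mat_adjoint ?J * U * ?J) $$ (i, j) = (\<Sum>l<?n. (mat_adjoint ?J * U) $$ (i, l) * ?J $$ (l, j))"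
    by (rule mult_mat_index) (use J J' U ij in auto)
  also have "\<dots> = (\<Sum>l<?n. if l = j then U $$ (i, j) else 0)"
    using ij row by (intro sum.cong) (auto simp: ancilla_isometry_eq simp del: index_mult_mat(1))
  also have "\<dots> = U $$ (i, j)" using order.strict_trans2[OF ij(2) le] by simp
  finally show "(mat_adjoint ?J * U * ?J) $$ (i, j) = mat d d (\<lambda>(i, j). U $$ (i, j)) $$ (i, j)"
    using ij by simp
qed (auto simp: ancilla_isometry_eq)

text \<open>The swap partner of an index below d is at least d, so the leading block contains only
  diagonal entries: \<open>- s\<close> at z and 0 elsewhere.\<close>

lemma search_unitary_block_encoding:
  assumes "z < d" "1 \<le> a" "0 < \<Delta>" "\<Delta> \<le> \<alpha>"
  shows "block_encoding \<alpha> a d (search_unitary (2 ^ a * d) d (\<Delta> / \<alpha>) z) (search_hamiltonian d \<Delta> z)"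
proof -
  \<comment> \<open>One ancilla qubit is enough to provide the two ancilla values that get
    coupled.\<close>
  have "(2::nat) ^ 1 \<le> 2 ^ a" using assms(2) by (intro power_increasing) auto
  then have n: "2 * d \<le> 2 ^ a * d" by simp
  have s: "(\<Delta> / \<alpha>)\<^sup>2 \<le> 1" using assms(3,4) by (simp add: power_le_one)
  have le: "i < 2 ^ a * d" if "i < d" for i using that n by linarith
  have "complex_of_real \<alpha> \<cdot>\<^sub>m mat d d (\<lambda>(i, j). search_unitary (2 ^ a * d) d (\<Delta> / \<alpha>) z $$ (i, j))
    = search_hamiltonian d \<Delta> z"
    by (rule eq_matI)
      (use assms n le in \<open>auto simp: search_hamiltonian_def outer_prod_def search_unitary_def swap_mat_def swap_idx_def\<close>)
  then show ?thesis
    using search_unitary_unitary[OF assms(1) n s] by (simp add: block_encoding_def ancilla_block)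
qed

subsection \<open>Spectrum of the search Hamiltonians\<close>

lemma search_hamiltonian_mult_vec:
  assumes "z < d" "v \<in> carrier_vec d"
  shows "search_hamiltonian d \<Delta> z *\<^sub>v v = (- complex_of_real \<Delta> * v $ z) \<cdot>\<^sub>v ket d z"
proof (rule eq_vecI)
  fix i assume "i < dim_vec ((- complex_of_real \<Delta> * v $ z) \<cdot>\<^sub>v ket d z)"
  then have i: "i < d" by simp
  have "(search_hamiltonian d \<Delta> z *\<^sub>v v) $ i
      = (\<Sum>k<d. search_hamiltonian d \<Delta> z $$ (i, k) * v $ k)"
    using assms i by (auto simp: search_hamiltonian_def outer_prod_def scalar_prod_def atLeast0LessThan
      intro!: sum.cong)
  also have "\<dots> = (\<Sum>k<d. if k = z then (if i = z then - complex_of_real \<Delta> * v $ z else 0) else 0)"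
    using assms i by (intro sum.cong refl) (auto simp: search_hamiltonian_def outer_prod_def)
  finally show "(search_hamiltonian d \<Delta> z *\<^sub>v v) $ i = ((- complex_of_real \<Delta> * v $ z) \<cdot>\<^sub>v ket d z) $ i"
    using assms i by simp
qed (auto simp: search_hamiltonian_def outer_prod_def)

lemma eigenvector_search_hamiltonian:
  assumes "z < d"
  shows "eigenvector (search_hamiltonian d \<Delta> z) v k \<longleftrightarrow>
    v \<in> carrier_vec d \<and> (\<exists>i<d. v $ i \<noteq> 0) \<and>
    (\<forall>i<d. (if i = z then - complex_of_real \<Delta> * v $ i else 0) = k * v $ i)"
proof -
  have nz: "v \<noteq> 0\<^sub>v d \<longleftrightarrow> (\<exists>i<d. v $ i \<noteq> 0)" if "v \<in> carrier_vec d"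
    using that by (auto intro!: eq_vecI)
  have eq: "(- complex_of_real \<Delta> * v $ z) \<cdot>\<^sub>v ket d z = k \<cdot>\<^sub>v v \<longleftrightarrow>
    (\<forall>i<d. (if i = z then - complex_of_real \<Delta> * v $ i else 0) = k * v $ i)" if "v \<in> carrier_vec d"
    using that assms by (auto simp: vec_eq_iff)
  have dim: "dim_row (search_hamiltonian d \<Delta> z) = d"
    by (simp add: search_hamiltonian_def outer_prod_def)
  show ?thesis
    unfolding eigenvector_def dim
    by (cases "v \<in> carrier_vec d") (simp_all only: nz eq search_hamiltonian_mult_vec[OF assms] simp_thms)
qed

lemma spectrum_search_hamiltonian:
  assumes "z < d" "2 \<le> d"
  shows "spectrum (search_hamiltonian d \<Delta> z) = {complex_of_real (- \<Delta>), 0}"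
proof (intro subset_antisym subsetI)
  fix k assume "k \<in> spectrum (search_hamiltonian d \<Delta> z)"
  then obtain v where "eigenvector (search_hamiltonian d \<Delta> z) v k"
    by (auto simp: spectrum_def eigenvalue_def)
  then obtain i where "i < d" "v $ i \<noteq> 0" "(if i = z then - complex_of_real \<Delta> * v $ i else 0) = k * v $ i"
    using eigenvector_search_hamiltonian[OF assms(1)] by blast
  \<comment> \<open>A nonzero coordinate of the eigenvector determines the eigenvalue: it is
    -\<Delta> if i = z, and 0 otherwise.\<close>
  then have "(- complex_of_real \<Delta> - k) * v $ i = 0 \<or> k = 0"
    by (auto simp: algebra_simps split: if_splits)
  then show "k \<in> {complex_of_real (- \<Delta>), 0}" using \<open>v $ i \<noteq> 0\<close> by auto
next
  fix k assume k: "k \<in> {complex_of_real (- \<Delta>), 0}"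
  \<comment> \<open>Any label other than z gives an eigenvector for 0; one exists because d is at
    least 2.\<close>
  define w where "w = (if z = 0 then 1 else 0 :: nat)"
  have "w < d" "w \<noteq> z" using assms by (auto simp: w_def)
  then have "eigenvector (search_hamiltonian d \<Delta> z) (ket d w) 0"
    using assms by (auto simp: eigenvector_search_hamiltonian)
  moreover have "eigenvector (search_hamiltonian d \<Delta> z) (ket d z) (complex_of_real (- \<Delta>))"
    using assms by (auto simp: eigenvector_search_hamiltonian)
  ultimately show "k \<in> spectrum (search_hamiltonian d \<Delta> z)"
    using k by (auto simp: spectrum_def eigenvalue_def)
qed

lemma ground_energy_search_hamiltonian:
  assumes "z < d" "2 \<le> d" "0 < \<Delta>"
  shows "ground_energy (search_hamiltonian d \<Delta> z) = - \<Delta>"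
  using assms by (simp add: ground_energy_def spectrum_search_hamiltonian)

lemma spectral_gap_search_hamiltonian:
  assumes "z < d" "2 \<le> d" "0 < \<Delta>"
  shows "spectral_gap (search_hamiltonian d \<Delta> z) = \<Delta>"
proof -
  have "{- \<Delta>, 0} - {- \<Delta>} = {0}" using assms(3) by auto
  then show ?thesis
    using assms by (simp add: spectral_gap_def ground_energy_search_hamiltonian spectrum_search_hamiltonian)
qed

lemma unique_ground_state_search_hamiltonian:
  assumes "z < d" "2 \<le> d" "0 < \<Delta>"
  shows "unique_ground_state (search_hamiltonian d \<Delta> z) (ket d z)"
  unfolding unique_ground_state_def
proof (intro conjI allI impI)
  have "ket d z \<bullet>c ket d z = 1"
    using assms(1) by (simp add: scalar_prod_left_unit)
  then show "ground_state (search_hamiltonian d \<Delta> z) (ket d z)"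
    using assms by (auto simp: ground_state_def ground_energy_search_hamiltonian eigenvector_search_hamiltonian)
  fix w assume "ground_state (search_hamiltonian d \<Delta> z) w"
  then have "eigenvector (search_hamiltonian d \<Delta> z) w (complex_of_real (- \<Delta>))"
    using assms by (simp add: ground_state_def ground_energy_search_hamiltonian)
  then have w: "w \<in> carrier_vec d" "\<And>i. i < d \<Longrightarrow> i \<noteq> z \<Longrightarrow> w $ i = 0"
    using assms(1,3) by (auto simp: eigenvector_search_hamiltonian)
  have "w = w $ z \<cdot>\<^sub>v ket d z"
    by (rule eq_vecI) (use w assms(1) in auto)
  then show "\<exists>k. w = k \<cdot>\<^sub>v ket d z" by blast
qed

lemma uniform_state_overlap:
  assumes "z < d"
  shows "cmod (uniform_state d \<bullet>c ket d z) = 1 / sqrt (real d)"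
proof -
  have "uniform_state d \<bullet>c ket d z = (\<Sum>i<d. if i = z then complex_of_real (1 / sqrt (real d)) else 0)"
    using assms by (auto simp: uniform_state_def scalar_prod_def atLeast0LessThan intro!: sum.cong simp del: sum.delta sum.delta')
  then show ?thesis using assms by (simp add: norm_divide)
qed

subsection \<open>The hybrid argument\<close>

text \<open>Cauchy-Schwarz against the constant 1. It produces the factor sqrt(d) both for the query
  errors and for the overlaps of the blank run.\<close>

lemma sum_sqrt_le:
  fixes f :: "'a \<Rightarrow> real"
  assumes "\<And>i. i \<in> I \<Longrightarrow> 0 \<le> f i"
  shows "(\<Sum>i\<in>I. sqrt (f i)) \<le> sqrt (real (card I)) * sqrt (\<Sum>i\<in>I. f i)"
proof -
  have "(\<Sum>i\<in>I. sqrt (f i))\<^sup>2 \<le> (\<Sum>i\<in>I. f i) * card I"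
    using sum_squared_le_sum_of_squares[of "\<lambda>i. sqrt (f i)" I] assms by simp
  then have "\<bar>\<Sum>i\<in>I. sqrt (f i)\<bar> \<le> sqrt ((\<Sum>i\<in>I. f i) * card I)"
    by (simp add: real_le_rsqrt)
  then show ?thesis by (simp add: real_sqrt_mult mult.commute)
qed

lemma psd_form_cong:
  assumes "psd_form n q" "\<And>A. A \<in> carrier_mat n n \<Longrightarrow> q' A = q A"
  shows "psd_form n q'"
  using assms by (simp add: psd_form_def)

lemma apply_on_mult_carrier [simp]:
  "A \<in> carrier_mat N m \<Longrightarrow> apply_on N S U * A \<in> carrier_mat N m"
  by (rule mult_carrier_mat[OF apply_on_carrier])

text \<open>This is the squared Hilbert-Schmidt norm of A sqrt(\<rho>); for a pure state it is the
  squared norm of \<open>A\<close> applied to the state vector. It takes arbitrary matrices because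
  differences of circuits are not unitary.\<close>

definition sqnorm :: "complex mat \<Rightarrow> complex mat \<Rightarrow> real" where
  "sqnorm \<rho> A = Re (mtrace (conj_by A \<rho>))"

lemma sqnorm_eq_sum:
  assumes "\<rho> \<in> carrier_mat n n" "A \<in> carrier_mat m n"
  shows "sqnorm \<rho> A = (\<Sum>i<m. Re (conj_by A \<rho> $$ (i, i)))"
proof -
  have "dim_row (conj_by A \<rho>) = m" using assms by (simp add: conj_by_def)
  then show ?thesis by (simp add: sqnorm_def mtrace_def)
qed

lemma density_operatorD:
  assumes "density_operator n \<rho>"
  shows "\<rho> \<in> carrier_mat n n" "mtrace \<rho> = 1"
  using assms by (auto simp: density_operator_def)

lemma psd_form_sqnorm:
  assumes "density_operator n \<rho>"
  shows "psd_form n (sqnorm \<rho>)"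
proof (rule psd_form_cong)
  show "psd_form n (\<lambda>A. \<Sum>i<n. Re (conj_by (1\<^sub>m n * A) \<rho> $$ (i, i)))"
    by (intro psd_form_sum psd_form_conj_by_diag assms) auto
qed (simp add: sqnorm_eq_sum[OF density_operatorD(1)[OF assms]])

lemma sqnorm_unitary_mult:
  assumes "\<rho> \<in> carrier_mat n n" "is_unitary n V" "A \<in> carrier_mat n n"
  shows "sqnorm \<rho> (V * A) = sqnorm \<rho> A"
proof -
  have "V \<in> carrier_mat n n" using assms(2) by (simp add: is_unitary_def)
  then have "conj_by (V * A) \<rho> = conj_by V (conj_by A \<rho>)"
    using assms(1,3) by (simp add: conj_by_conj_by[of V n n A n])
  then show ?thesis using assms by (simp add: sqnorm_def mtrace_conj_by_unitary)
qed

lemma sqnorm_unitary: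
  assumes "density_operator n \<rho>" "is_unitary n V"
  shows "sqnorm \<rho> V = 1"
  using density_operatorD[OF assms(1)] assms(2) by (simp add: sqnorm_def mtrace_conj_by_unitary)

text \<open>Cyclicity brings the two factors of the self-adjoint error together, and their product
  is diagonal by \<open>search_diff_square\<close>. What remains is the query weight on the two
  labels carrying z.\<close>

lemma sqnorm_search_diff:
  assumes \<rho>: "\<rho> \<in> carrier_mat N N" and S: "is_subsystem N S" and A: "A \<in> carrier_mat N N"
    and z: "z < d" and d: "2 * d \<le> sub_dim S" and s: "s\<^sup>2 \<le> 1"
  shows "sqnorm \<rho> (apply_on N S (search_diff (sub_dim S) d s z) * A) =
    (\<Sum>i<N. (if fst (sub_coords S i) = z \<or> fst (sub_coords S i) = z + d then 2 - 2 * sqrt (1 - s\<^sup>2) else 0)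
       * Re (conj_by A \<rho> $$ (i, i)))"
proof -
  let ?D = "search_diff (sub_dim S) d s z"
  let ?f = "\<lambda>x. if x = z \<or> x = z + d then 2 - 2 * sqrt (1 - s\<^sup>2) else 0"
  have X: "conj_by A \<rho> \<in> carrier_mat N N" using A \<rho> by simp
  have "mtrace (conj_by (apply_on N S ?D * A) \<rho>) = mtrace (conj_by (apply_on N S ?D) (conj_by A \<rho>))"
    using A \<rho> by (simp add: conj_by_conj_by[of _ N N A N])
  also have "\<dots> = mtrace (apply_on N S (?D * ?D) * conj_by A \<rho>)"
    by (simp add: mtrace_conj_by[OF apply_on_carrier X] apply_on_adjoint[OF S] apply_on_mult[OF S]
        search_diff_adjoint[OF z])
  also have "\<dots> = (\<Sum>i<N. complex_of_real (?f (fst (sub_coords S i))) * conj_by A \<rho> $$ (i, i))"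
    unfolding search_diff_square[OF z d s]
    by (subst mtrace_apply_on_diag[OF S X]) (auto simp: swap_mat_def sub_coords_range[OF S] intro!: sum.cong)
  finally show ?thesis unfolding sqnorm_def by simp
qed

lemma sum_sqnorm_search_diff_le:
  assumes \<rho>: "density_operator N \<rho>" and S: "is_subsystem N S" and A: "A \<in> carrier_mat N N"
    and d: "2 * d \<le> sub_dim S" and s: "0 \<le> s" "s \<le> 1"
  shows "(\<Sum>z<d. sqnorm \<rho> (apply_on N S (search_diff (sub_dim S) d s z) * A)) \<le> 2 * s\<^sup>2 * sqnorm \<rho> A"
proof -
  let ?e = "2 - 2 * sqrt (1 - s\<^sup>2)" and ?X = "\<lambda>i. Re (conj_by A \<rho> $$ (i, i))"
  let ?x = "\<lambda>i. fst (sub_coords S i)"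
  note C\<rho> = density_operatorD(1)[OF \<rho>]
  have s2: "s\<^sup>2 \<le> 1" using s by (simp add: power_le_one)
  \<comment> \<open>Hence 1 - s^2 \<le> sqrt(1 - s^2), which bounds 2 - 2 sqrt(1 - s^2) by 2
    s^2.\<close>
  have "(1 - s\<^sup>2)\<^sup>2 \<le> 1 - s\<^sup>2"
    using s2 by (simp add: power2_eq_square mult_left_le)
  then have e: "?e \<le> 2 * s\<^sup>2" using real_le_rsqrt by fastforce
  have e0: "0 \<le> ?e" by simp
  have X0: "0 \<le> ?X i" if "i < N" for i by (rule Re_conj_by_diag_nonneg[OF \<rho> A that])
  have count: "(\<Sum>z<d. if x = z \<or> x = z + d then ?e else 0) \<le> ?e" for x
  proof -
    have "(\<Sum>z<d. if x = z \<or> x = z + d then ?e else 0)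
      = (\<Sum>z<d. if z = (if x < d then x else x - d) then (if x < 2 * d then ?e else 0) else 0)"
      by (intro sum.cong refl) auto
    also have "\<dots> \<le> ?e" using e0 by simp
    finally show ?thesis .
  qed
  have "(\<Sum>z<d. sqnorm \<rho> (apply_on N S (search_diff (sub_dim S) d s z) * A))
      = (\<Sum>z<d. \<Sum>i<N. (if ?x i = z \<or> ?x i = z + d then ?e else 0) * ?X i)"
    by (intro sum.cong refl sqnorm_search_diff C\<rho> S A d s2) simp
  also have "\<dots> = (\<Sum>i<N. (\<Sum>z<d. if ?x i = z \<or> ?x i = z + d then ?e else 0) * ?X i)"
    by (subst sum.swap) (simp only: sum_distrib_right)
  also have "\<dots> \<le> (\<Sum>i<N. ?e * ?X i)"
    by (intro sum_mono mult_right_mono count X0) simp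
  also have "\<dots> = ?e * sqnorm \<rho> A"
    by (simp only: sqnorm_eq_sum[OF C\<rho> A] sum_distrib_left)
  also have "\<dots> \<le> 2 * s\<^sup>2 * sqnorm \<rho> A"
    using e psd_formD_nonneg[OF psd_form_sqnorm[OF \<rho>] A] by (rule mult_right_mono)
  finally show ?thesis .
qed

text \<open>The most recently applied unitary is the head of the list.\<close>

primrec circuit :: "nat \<Rightarrow> subsystem \<Rightarrow> complex mat \<Rightarrow> complex mat \<Rightarrow> complex mat list \<Rightarrow> complex mat" where
  "circuit N S U V\<^sub>0 [] = V\<^sub>0"
| "circuit N S U V\<^sub>0 (V # Vs) = V * (apply_on N S U * circuit N S U V\<^sub>0 Vs)"

lemma circuit_unitary:
  assumes "is_subsystem N S" "is_unitary (sub_dim S) U" "is_unitary N V\<^sub>0" "\<forall>V\<in>set Vs. is_unitary N V"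
  shows "is_unitary N (circuit N S U V\<^sub>0 Vs)"
  using assms(4)
  by (induction Vs) (simp_all add: assms is_unitary_mult apply_on_unitary)

lemma final_state_circuit:
  assumes "valid_algorithm a d \<A>" "is_unitary (2 ^ a * d) U" "mat_adjoint U = U"
  shows "final_state \<A> U = conj_by
    (circuit (ws_dim \<A>) (query_sub \<A>) U (init_unitary \<A>) (rev (map snd (query_steps \<A>)))) (init_state \<A>)"
proof -
  let ?N = "ws_dim \<A>" and ?S = "query_sub \<A>"
  let ?C = "\<lambda>xs. circuit ?N ?S U (init_unitary \<A>) (rev (map snd xs))"
  have S: "is_subsystem ?N ?S" "sub_dim ?S = 2 ^ a * d"
    and V0: "is_unitary ?N (init_unitary \<A>)" and \<rho>: "init_state \<A> \<in> carrier_mat ?N ?N"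
    and V: "\<forall>(t, V)\<in>set (query_steps \<A>). is_unitary ?N V"
    using assms(1) by (auto simp: valid_algorithm_def density_operator_def)
  have q: "query_unitary t U = U" for t using assms(3) by (cases t) auto
  have "foldl (\<lambda>\<rho> (t, V). conj_by V (conj_by (apply_on ?N ?S (query_unitary t U)) \<rho>))
       (conj_by (init_unitary \<A>) (init_state \<A>)) xs = conj_by (?C xs) (init_state \<A>)"
    if "\<forall>(t, V)\<in>set xs. is_unitary ?N V" for xs
    using that
  proof (induction xs rule: rev_induct)
    case Nil
    show ?case by simp
  next
    case (snoc tV xs)
    obtain t V where tV: "tV = (t, V)" by (cases tV)
    have "is_unitary ?N (?C xs)"
      using snoc.prems assms(2) S V0 by (intro circuit_unitary) auto
    then have "?C xs \<in> carrier_mat ?N ?N" "V \<in> carrier_mat ?N ?N"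
      using snoc.prems by (auto simp: is_unitary_def tV)
    then show ?case
      using snoc \<rho> by (simp add: tV q conj_by_conj_by[of _ ?N ?N _ ?N] case_prod_unfold)
  qed
  from this[OF V] show ?thesis by (simp add: final_state_def)
qed

text \<open>In one step the difference splits as U W - U_0 B = U (W - B) + (U - U_0) B, where B is
  the blank run. The unitary in the first term preserves the norm. The error in the second acts on
  B, which is the same for all z; only thus can the query weights be summed over z.\<close>

lemma sum_circuit_distance_le:
  assumes \<rho>: "density_operator N \<rho>" and S: "is_subsystem N S" and V0: "is_unitary N V\<^sub>0"
    and d: "2 * d \<le> sub_dim S" and s: "0 \<le> s" "s \<le> 1" and Vs: "\<forall>V\<in>set Vs. is_unitary N V"
  shows "(\<Sum>z<d. sqrt (sqnorm \<rho> (circuit N S (search_unitary (sub_dim S) d s z) V\<^sub>0 Vs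
      - circuit N S (blank_unitary (sub_dim S) d) V\<^sub>0 Vs))) \<le> real (length Vs) * (sqrt 2 * s * sqrt (real d))"
  using Vs
proof (induction Vs)
  case Nil
  have "V\<^sub>0 \<in> carrier_mat N N" using V0 by (simp add: is_unitary_def)
  then have "V\<^sub>0 - V\<^sub>0 = 0\<^sub>m N N" "conj_by (0\<^sub>m N N) \<rho> = 0\<^sub>m N N"
    using density_operatorD(1)[OF \<rho>] by (auto simp: conj_by_def)
  then have "sqnorm \<rho> (V\<^sub>0 - V\<^sub>0) = 0" by (simp add: sqnorm_def mtrace_def)
  then show ?case by simp
next
  case (Cons V Vs)
  let ?n = "sub_dim S"
  let ?W = "\<lambda>U. circuit N S U V\<^sub>0 Vs"
  let ?B = "?W (blank_unitary ?n d)"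
  let ?E = "\<lambda>z. ?W (search_unitary ?n d s z) - ?B"
  let ?O = "apply_on N S"
  have s2: "s\<^sup>2 \<le> 1" using s by (simp add: power_le_one)
  note C\<rho> = density_operatorD(1)[OF \<rho>]
  have V: "is_unitary N V" and VC: "V \<in> carrier_mat N N" and Vs: "\<forall>V\<in>set Vs. is_unitary N V"
    using Cons.prems by (auto simp: is_unitary_def)
  have B: "is_unitary N ?B"
    by (rule circuit_unitary[OF S blank_unitary_unitary[OF d] V0 Vs])
  then have BC: "?B \<in> carrier_mat N N" by (simp add: is_unitary_def)
  have step: "sqrt (sqnorm \<rho> (V * (?O (search_unitary ?n d s z) * ?W (search_unitary ?n d s z))
        - V * (?O (blank_unitary ?n d) * ?B)))
      \<le> sqrt (sqnorm \<rho> (?E z)) + sqrt (sqnorm \<rho> (?O (search_diff ?n d s z) * ?B))" if z: "z < d" for z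
  proof -
    let ?U = "search_unitary ?n d s z" and ?D = "search_diff ?n d s z"
    have U: "is_unitary ?n ?U" by (rule search_unitary_unitary[OF z d s2])
    have "is_unitary N (?W ?U)" by (rule circuit_unitary[OF S U V0 Vs])
    then have WC: "?W ?U \<in> carrier_mat N N" by (simp add: is_unitary_def)
    have EC: "?E z \<in> carrier_mat N N" using WC BC by (intro minus_carrier_mat)
    note C = EC WC BC WC[THEN apply_on_mult_carrier] BC[THEN apply_on_mult_carrier] EC[THEN apply_on_mult_carrier]
    have split: "?O ?U * ?B = ?O (blank_unitary ?n d) * ?B + ?O ?D * ?B"
      using apply_on_add[OF S, of "blank_unitary ?n d" ?D] search_unitary_decomp[OF z, of ?n s] BC
      by (simp add: add_mult_distrib_mat[of _ N N _ _ N])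
    have "V * (?O ?U * ?W ?U) - V * (?O (blank_unitary ?n d) * ?B)
        = V * (?O ?U * ?W ?U - ?O (blank_unitary ?n d) * ?B)"
      by (rule mult_minus_distrib_mat[symmetric, OF VC C(4,5)])
    also have "?O ?U * ?W ?U - ?O (blank_unitary ?n d) * ?B
        = (?O ?U * ?W ?U - ?O ?U * ?B) + ?O ?D * ?B"
      unfolding split by (rule eq_matI)
        (use C[THEN carrier_matD(1)] C[THEN carrier_matD(2)] in \<open>simp_all del: index_mult_mat\<close>)
    also have "?O ?U * ?W ?U - ?O ?U * ?B = ?O ?U * ?E z"
      by (rule mult_minus_distrib_mat[symmetric, OF apply_on_carrier C(2,3)])
    finally have "sqrt (sqnorm \<rho> (V * (?O ?U * ?W ?U) - V * (?O (blank_unitary ?n d) * ?B)))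
        = sqrt (sqnorm \<rho> (?O ?U * ?E z + ?O ?D * ?B))"
      using C by (simp add: sqnorm_unitary_mult[OF C\<rho> V])
    also have "\<dots> \<le> sqrt (sqnorm \<rho> (?O ?U * ?E z)) + sqrt (sqnorm \<rho> (?O ?D * ?B))"
      by (rule psd_form_triangle[OF psd_form_sqnorm[OF \<rho>] C(6,5)])
    also have "sqnorm \<rho> (?O ?U * ?E z) = sqnorm \<rho> (?E z)"
      by (rule sqnorm_unitary_mult[OF C\<rho> apply_on_unitary[OF S U] EC])
    finally show ?thesis .
  qed
  have "(\<Sum>z<d. sqrt (sqnorm \<rho> (?O (search_diff ?n d s z) * ?B)))
      \<le> sqrt (real d) * sqrt (\<Sum>z<d. sqnorm \<rho> (?O (search_diff ?n d s z) * ?B))"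
    using BC sum_sqrt_le[of "{..<d}" "\<lambda>z. sqnorm \<rho> (?O (search_diff ?n d s z) * ?B)"]
    by (simp add: psd_formD_nonneg[OF psd_form_sqnorm[OF \<rho>]] mult_carrier_mat[of _ N N])
  \<comment> \<open>The last factor 1 is the squared norm of the unitary blank circuit.\<close>
  also have "\<dots> \<le> sqrt (real d) * sqrt (2 * s\<^sup>2 * 1)"
    using sum_sqnorm_search_diff_le[OF \<rho> S BC d s] sqnorm_unitary[OF \<rho> B]
    by (intro mult_left_mono real_sqrt_le_mono) auto
  finally have diff: "(\<Sum>z<d. sqrt (sqnorm \<rho> (?O (search_diff ?n d s z) * ?B))) \<le> sqrt 2 * s * sqrt (real d)"
    using s by (simp add: real_sqrt_mult mult_ac)
  have "(\<Sum>z<d. sqrt (sqnorm \<rho> (V * (?O (search_unitary ?n d s z) * ?W (search_unitary ?n d s z))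
        - V * (?O (blank_unitary ?n d) * ?B))))
      \<le> (\<Sum>z<d. sqrt (sqnorm \<rho> (?E z)) + sqrt (sqnorm \<rho> (?O (search_diff ?n d s z) * ?B)))"
    by (intro sum_mono step) simp
  also have "\<dots> \<le> real (length Vs) * (sqrt 2 * s * sqrt (real d)) + sqrt 2 * s * sqrt (real d)"
    unfolding sum.distrib by (intro add_mono diff Cons.IH Vs)
  finally show ?case by (simp add: algebra_simps)
qed

subsection \<open>Success probability\<close>

text \<open>
  The overlap of the output with \<open>ket d z\<close>, averaged over the measurement outcomes, as a
  quadratic form in the circuit.
\<close>

definition success_form :: "query_algorithm \<Rightarrow> nat \<Rightarrow> complex mat \<Rightarrow> real" where
  "success_form \<A> z A = (\<Sum>k<length (meas_ops \<A>). \<Sum>r<env_dim (out_sub \<A>).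
     Re (conj_by (apply_on (ws_dim \<A>) (meas_sub \<A>) (meas_ops \<A> ! k) * A) (init_state \<A>)
       $$ (sub_index (out_sub \<A>) z r, sub_index (out_sub \<A>) z r)))"

lemma valid_algorithmD:
  assumes "valid_algorithm a d \<A>"
  shows "density_operator (ws_dim \<A>) (init_state \<A>)" "is_unitary (ws_dim \<A>) (init_unitary \<A>)"
    "\<forall>V\<in>set (map snd (query_steps \<A>)). is_unitary (ws_dim \<A>) V"
    "is_subsystem (ws_dim \<A>) (query_sub \<A>)" "sub_dim (query_sub \<A>) = 2 ^ a * d"
    "is_subsystem (ws_dim \<A>) (meas_sub \<A>)" "measurement (sub_dim (meas_sub \<A>)) (meas_ops \<A>)"
    "is_subsystem (ws_dim \<A>) (out_sub \<A>)" "sub_dim (out_sub \<A>) = d"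
  using assms by (auto simp: valid_algorithm_def)

lemma psd_form_success_form:
  assumes "valid_algorithm a d \<A>" "z < d"
  shows "psd_form (ws_dim \<A>) (success_form \<A> z)"
  unfolding success_form_def
  by (intro psd_form_sum psd_form_conj_by_diag valid_algorithmD(1)[OF assms(1)] apply_on_carrier
      sub_index_less[OF valid_algorithmD(8)[OF assms(1)]])
    (use assms valid_algorithmD(9)[OF assms(1)] in auto)

text \<open>Summing over the output label completes the partial trace to a full trace, and
  completeness of the measurement then removes the measurement operators.\<close>

lemma sum_success_form:
  assumes valid: "valid_algorithm a d \<A>" and A: "A \<in> carrier_mat (ws_dim \<A>) (ws_dim \<A>)"
  shows "(\<Sum>z<d. success_form \<A> z A) = sqnorm (init_state \<A>) A"
proof -
  let ?N = "ws_dim \<A>" and ?S = "out_sub \<A>" and ?\<rho> = "init_state \<A>"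
  let ?K = "\<lambda>k. apply_on ?N (meas_sub \<A>) (meas_ops \<A> ! k)"
  note V = valid_algorithmD[OF valid]
  note C\<rho> = density_operatorD(1)[OF V(1)]
  have idx: "(\<Sum>z<d. \<Sum>r<env_dim ?S. f (sub_index ?S z r)) = (\<Sum>i<?N. f i)" for f :: "nat \<Rightarrow> real"
  proof -
    have "(\<Sum>zr\<in>{..<sub_dim ?S} \<times> {..<env_dim ?S}. f ((\<lambda>(x, r). sub_index ?S x r) zr)) = (\<Sum>i<?N. f i)"
      by (rule sum.reindex_bij_betw[OF V(8)[unfolded is_subsystem_def]])
    then show ?thesis by (simp add: V(9) sum.cartesian_product case_prod_unfold)
  qed
  have "(\<Sum>z<d. success_form \<A> z A) = (\<Sum>k<length (meas_ops \<A>). \<Sum>z<d. \<Sum>r<env_dim ?S.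
      Re (conj_by (?K k * A) ?\<rho> $$ (sub_index ?S z r, sub_index ?S z r)))"
    unfolding success_form_def by (rule sum.swap)
  also have "\<dots> = (\<Sum>k<length (meas_ops \<A>). sqnorm ?\<rho> (?K k * A))"
    by (simp only: idx[of "\<lambda>i. Re (conj_by (?K _ * A) ?\<rho> $$ (i, i))"]
        sqnorm_eq_sum[OF C\<rho> apply_on_mult_carrier[OF A]])
  also have "\<dots> = (\<Sum>k<length (meas_ops \<A>). Re (mtrace (conj_by (?K k) (conj_by A ?\<rho>))))"
    by (simp only: sqnorm_def conj_by_conj_by[OF apply_on_carrier A C\<rho>])
  also have "\<dots> = Re (mtrace (conj_by A ?\<rho>))"
    using measurement_mtrace[OF V(6) conj_by_carrier[OF A C\<rho>] V(7)] by (simp flip: Re_sum)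
  finally show ?thesis by (simp add: sqnorm_def)
qed

text \<open>One term of the nonnegative sum in \<open>sum_success_form\<close>. It is applied to the
  difference of two circuits.\<close>

lemma success_form_le_sqnorm:
  assumes "valid_algorithm a d \<A>" "z < d" "A \<in> carrier_mat (ws_dim \<A>) (ws_dim \<A>)"
  shows "success_form \<A> z A \<le> sqnorm (init_state \<A>) A"
  unfolding sum_success_form[OF assms(1,3), symmetric]
  by (rule member_le_sum) (use assms psd_formD_nonneg[OF psd_form_success_form[OF assms(1)]] in auto)

lemma expval_ket:
  assumes "M \<in> carrier_mat d d" "z < d"
  shows "expval M (ket d z) = M $$ (z, z)"
proof -
  have "expval M (ket d z) = (\<Sum>k<d. \<Sum>l<d. if l = z then (if k = z then M $$ (z, z) else 0) else 0)"
    using assms unfolding expval_sum[OF assms(1) unit_vec_carrier]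
    by (intro sum.cong refl) auto
  then show ?thesis using assms(2) by simp
qed

text \<open>\<open>g k\<close> is the unnormalised overlap, that is, outcome probability times
  overlap. Successful outcomes contribute at least 3/4 of their probability, and the others are
  nonnegative.\<close>

lemma success_prob_le_success_form:
  assumes valid: "valid_algorithm a d \<A>" and z: "z < d"
    and W: "W \<in> carrier_mat (ws_dim \<A>) (ws_dim \<A>)" "final_state \<A> U = conj_by W (init_state \<A>)"
  shows "3 / 4 * success_prob \<A> U (\<lambda>\<rho>. 3 / 4 \<le> Re (expval \<rho> (ket d z))) \<le> success_form \<A> z W"
proof -
  let ?N = "ws_dim \<A>" and ?S = "out_sub \<A>" and ?\<rho> = "init_state \<A>"
  let ?K = "\<lambda>k. apply_on ?N (meas_sub \<A>) (meas_ops \<A> ! k)"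
  note V = valid_algorithmD[OF valid]
  note C\<rho> = density_operatorD(1)[OF V(1)]
  define g where "g k = (\<Sum>r<env_dim ?S. Re (post_state \<A> U k $$ (sub_index ?S z r, sub_index ?S z r)))" for k
  have post: "post_state \<A> U k = conj_by (?K k * W) ?\<rho>" for k
    unfolding post_state_def W(2) by (rule conj_by_conj_by[OF apply_on_carrier W(1) C\<rho>])
  have KW: "?K k * W \<in> carrier_mat ?N ?N" for k using W(1) by simp
  have g: "0 \<le> g k" for k
    unfolding g_def post
    by (intro sum_nonneg Re_conj_by_diag_nonneg[OF V(1) KW] sub_index_less[OF V(8)]) (use z V(9) in auto)
  have prob: "0 \<le> outcome_prob \<A> U k" for k
    using psd_formD_nonneg[OF psd_form_sqnorm[OF V(1)] KW] by (simp add: outcome_prob_def post sqnorm_def)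
  have out: "Re (expval (output_state \<A> U k) (ket d z)) = 1 / outcome_prob \<A> U k * g k" for k
  proof -
    have "output_state \<A> U k \<in> carrier_mat d d"
      by (simp add: output_state_def reduced_state_def V(9))
    then show ?thesis
      using z by (simp add: expval_ket) (simp add: output_state_def reduced_state_def V(9) g_def)
  qed
  have good: "3 / 4 * outcome_prob \<A> U k \<le> g k"
    if "3 / 4 \<le> Re (expval (output_state \<A> U k) (ket d z))" for k
  proof (cases "outcome_prob \<A> U k = 0")
    \<comment> \<open>Here \<open>output_state\<close> is a dummy value, but the claim reduces to
      nonnegativity of \<open>g\<close>.\<close>
    case True
    then show ?thesis using g by simp
  next
    case False
    then have "0 < outcome_prob \<A> U k" using prob[of k] by simp
    then show ?thesis using that unfolding out by (simp add: field_simps)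
  qed
  have "3 / 4 * success_prob \<A> U (\<lambda>\<rho>. 3 / 4 \<le> Re (expval \<rho> (ket d z)))
      \<le> (\<Sum>k | k < length (meas_ops \<A>) \<and> 3 / 4 \<le> Re (expval (output_state \<A> U k) (ket d z)). g k)"
    unfolding success_prob_def sum_distrib_left by (intro sum_mono good) simp
  also have "\<dots> \<le> (\<Sum>k<length (meas_ops \<A>). g k)"
    by (intro sum_mono2) (auto simp: g)
  also have "\<dots> = success_form \<A> z W"
    by (simp add: g_def success_form_def post)
  finally show ?thesis .
qed

lemma query_lower_bound:
  assumes a: "1 \<le> a" and d: "0 < d" and \<Delta>: "0 < \<Delta>" "\<Delta> \<le> \<alpha>" and p: "0 \<le> p"
    and valid: "valid_algorithm a d \<A>" and prep: "prepares_ground_states \<alpha> a d \<Delta> p \<A>"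
  shows "sqrt (real d) * sqrt (3 / 4 * p) \<le> 1 + sqrt 2 * (\<Delta> / \<alpha>) * real (num_queries \<A>)"
proof -
  let ?N = "ws_dim \<A>" and ?S = "query_sub \<A>" and ?\<rho> = "init_state \<A>" and ?n = "2 ^ a * d"
  note V = valid_algorithmD[OF valid]
  define s where "s = \<Delta> / \<alpha>"
  have s: "0 \<le> s" "s \<le> 1" using \<Delta> by (auto simp: s_def)
  then have s2: "s\<^sup>2 \<le> 1" by (simp add: power_le_one)
  have "(2::nat) ^ 1 \<le> 2 ^ a" using a by (intro power_increasing) auto
  then have n: "2 * d \<le> ?n" by simp
  define Vs where "Vs = rev (map snd (query_steps \<A>))"
  have Vs: "\<forall>V\<in>set Vs. is_unitary ?N V" and len: "length Vs = num_queries \<A>"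
    using V(3) by (auto simp: Vs_def num_queries_def)
  define W where "W U = circuit ?N ?S U (init_unitary \<A>) Vs" for U
  have WU: "is_unitary ?N (W U)" if "is_unitary ?n U" for U
    unfolding W_def by (rule circuit_unitary[OF V(4) _ V(2) Vs]) (simp add: V(5) that)
  let ?B = "W (blank_unitary ?n d)" and ?W = "\<lambda>z. W (search_unitary ?n d s z)"
  have B: "is_unitary ?N ?B" by (rule WU[OF blank_unitary_unitary[OF n]])
  then have BC: "?B \<in> carrier_mat ?N ?N" by (simp add: is_unitary_def)
  have step: "sqrt (3 / 4 * p) \<le> sqrt (success_form \<A> z ?B) + sqrt (sqnorm ?\<rho> (?W z - ?B))" if z: "z < d" for z
  proof -
    let ?U = "search_unitary ?n d s z"
    have U: "is_unitary ?n ?U" by (rule search_unitary_unitary[OF z n s2])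
    then have WC: "?W z \<in> carrier_mat ?N ?N" using WU by (simp add: is_unitary_def)
    have DC: "?W z - ?B \<in> carrier_mat ?N ?N" using BC by (rule minus_carrier_mat)
    have "block_encoding \<alpha> a d ?U (search_hamiltonian d \<Delta> z)"
      unfolding s_def by (rule search_unitary_block_encoding[OF z a \<Delta>])
    then have "p \<le> success_prob \<A> ?U (\<lambda>\<rho>. 3 / 4 \<le> Re (expval \<rho> (ket d z)))"
      using prep z by (simp add: prepares_ground_states_def)
    moreover have "final_state \<A> ?U = conj_by (?W z) ?\<rho>"
      unfolding W_def Vs_def by (rule final_state_circuit[OF valid U search_unitary_adjoint[OF z]])
    ultimately have "3 / 4 * p \<le> success_form \<A> z (?W z)"
      using success_prob_le_success_form[OF valid z WC] by fastforce
    then have "sqrt (3 / 4 * p) \<le> sqrt (success_form \<A> z (?W z))" by simp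
    \<comment> \<open>Comparison with the blank run: the overlap must come either from the blank
      circuit or from the distance to it.\<close>
    also have "?W z = ?B + (?W z - ?B)"
      by (rule eq_matI) (use WC BC in auto)
    also have "sqrt (success_form \<A> z (?B + (?W z - ?B)))
        \<le> sqrt (success_form \<A> z ?B) + sqrt (success_form \<A> z (?W z - ?B))"
      by (rule psd_form_triangle[OF psd_form_success_form[OF valid z] BC DC])
    also have "\<dots> \<le> sqrt (success_form \<A> z ?B) + sqrt (sqnorm ?\<rho> (?W z - ?B))"
      using success_form_le_sqnorm[OF valid z DC] by simp
    finally show ?thesis .
  qed
  have "(\<Sum>z<d. sqrt (success_form \<A> z ?B)) \<le> sqrt (real d) * sqrt (\<Sum>z<d. success_form \<A> z ?B)"
    using sum_sqrt_le[of "{..<d}" "\<lambda>z. success_form \<A> z ?B"]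
    by (simp add: psd_formD_nonneg[OF psd_form_success_form[OF valid] BC])
  also have "(\<Sum>z<d. success_form \<A> z ?B) = 1"
    using sum_success_form[OF valid BC] sqnorm_unitary[OF V(1) B] by simp
  finally have blank: "(\<Sum>z<d. sqrt (success_form \<A> z ?B)) \<le> sqrt (real d)" by simp
  have dist: "(\<Sum>z<d. sqrt (sqnorm ?\<rho> (?W z - ?B))) \<le> real (num_queries \<A>) * (sqrt 2 * s * sqrt (real d))"
    using sum_circuit_distance_le[OF V(1,4,2) _ s Vs, of d] n by (simp add: W_def V(5) len)
  have "real d * sqrt (3 / 4 * p) = (\<Sum>z<d. sqrt (3 / 4 * p))" by simp
  also have "\<dots> \<le> (\<Sum>z<d. sqrt (success_form \<A> z ?B) + sqrt (sqnorm ?\<rho> (?W z - ?B)))"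
    by (intro sum_mono step) simp
  also have "\<dots> \<le> sqrt (real d) * (1 + sqrt 2 * s * real (num_queries \<A>))"
    using add_mono[OF blank dist] by (simp add: sum.distrib algebra_simps)
  finally have "sqrt (real d) * (sqrt (real d) * sqrt (3 / 4 * p))
      \<le> sqrt (real d) * (1 + sqrt 2 * s * real (num_queries \<A>))"
    by (simp flip: mult.assoc)
  then show ?thesis using d by (simp add: s_def)
qed

theorem corollary7:
  fixes \<alpha>\<^sub>1 \<alpha>\<^sub>2 p :: real
  assumes "0 < \<alpha>\<^sub>1" and "\<alpha>\<^sub>1 \<le> \<alpha>\<^sub>2" and "0 < p" and "p \<le> 1"
  shows "\<exists>(c::real) (d\<^sub>0::nat). c > 0 \<and> d\<^sub>0 \<ge> 2 \<and>
    (\<forall>(d::nat) (a::nat) (\<alpha>::real) (\<Delta>::real).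
       d \<ge> d\<^sub>0 \<and> a \<ge> 1 \<and> \<alpha>\<^sub>1 \<le> \<alpha> \<and> \<alpha> \<le> \<alpha>\<^sub>2 \<and> 0 < \<Delta> \<and> \<Delta> \<le> \<alpha> \<longrightarrow>
       (let \<gamma> = 1 / sqrt (real d) in
         (\<forall>z<d. unique_ground_state (search_hamiltonian d \<Delta> z) (ket d z) \<and>
                spectral_gap (search_hamiltonian d \<Delta> z) = \<Delta> \<and>
                cmod (uniform_state d \<bullet>c ket d z) = \<gamma>) \<and>
         (\<forall>\<A>. valid_algorithm a d \<A> \<and> prepares_ground_states \<alpha> a d \<Delta> p \<A> \<longrightarrow>
                real (num_queries \<A>) \<ge> c * sqrt (real d) / \<Delta> \<and>
                c * sqrt (real d) / \<Delta> = c / (\<gamma> * \<Delta>))))"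
proof -
  define q where "q = sqrt (3 / 4 * p)"
  \<comment> \<open>The choice of \<open>d\<^sub>0\<close> makes sqrt(d) q at least 2, so the
    additive 1 in \<open>query_lower_bound\<close> costs at most half of the left side. Solving the
    other half for Q gives this \<open>c\<close>, with \<alpha> replaced by its lower bound to make
    the constant uniform.\<close>
  define c where "c = \<alpha>\<^sub>1 * q / (2 * sqrt 2)"
  define d\<^sub>0 where "d\<^sub>0 = max 2 (nat \<lceil>(2 / q)\<^sup>2\<rceil>)"
  have q: "0 < q" using assms(3) by (simp add: q_def)
  have c: "0 < c" using assms(1) q by (simp add: c_def)
  have bound: "c * sqrt (real d) / \<Delta> \<le> real (num_queries \<A>)"
    if d: "d\<^sub>0 \<le> d" and a: "1 \<le> a" and \<alpha>: "\<alpha>\<^sub>1 \<le> \<alpha>" and \<Delta>: "0 < \<Delta>" "\<Delta> \<le> \<alpha>"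
      and \<A>: "valid_algorithm a d \<A>" "prepares_ground_states \<alpha> a d \<Delta> p \<A>" for d a \<alpha> \<Delta> \<A>
  proof -
    let ?Q = "real (num_queries \<A>)"
    have "(2 / q)\<^sup>2 \<le> real d" using d unfolding d\<^sub>0_def by linarith
    then have "2 / q \<le> sqrt (real d)" by (rule real_le_rsqrt)
    then have "1 \<le> sqrt (real d) * q / 2" using q by (simp add: field_simps)
    moreover have "sqrt (real d) * q \<le> 1 + sqrt 2 * (\<Delta> / \<alpha>) * ?Q"
      unfolding q_def by (rule query_lower_bound[OF a _ \<Delta> _ \<A>]) (use d assms(3) in \<open>auto simp: d\<^sub>0_def\<close>)
    moreover have "sqrt 2 * (\<Delta> / \<alpha>) * ?Q \<le> sqrt 2 * (\<Delta> / \<alpha>\<^sub>1) * ?Q"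
      using \<alpha> \<Delta> assms(1) by (intro mult_right_mono mult_left_mono divide_left_mono) auto
    ultimately have "sqrt (real d) * q / 2 \<le> sqrt 2 * (\<Delta> / \<alpha>\<^sub>1) * ?Q" by linarith
    then show ?thesis using \<Delta>(1) assms(1) by (simp add: c_def field_simps)
  qed
  show ?thesis
  proof (intro exI[of _ c] exI[of _ d\<^sub>0] conjI allI impI)
    fix d a :: nat and \<alpha> \<Delta> :: real
    assume *: "d\<^sub>0 \<le> d \<and> 1 \<le> a \<and> \<alpha>\<^sub>1 \<le> \<alpha> \<and> \<alpha> \<le> \<alpha>\<^sub>2 \<and> 0 < \<Delta> \<and> \<Delta> \<le> \<alpha>"
    then have "2 \<le> d" by (simp add: d\<^sub>0_def)
    with * bound show "let \<gamma> = 1 / sqrt (real d) in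
         (\<forall>z<d. unique_ground_state (search_hamiltonian d \<Delta> z) (ket d z) \<and>
                spectral_gap (search_hamiltonian d \<Delta> z) = \<Delta> \<and>
                cmod (uniform_state d \<bullet>c ket d z) = \<gamma>) \<and>
         (\<forall>\<A>. valid_algorithm a d \<A> \<and> prepares_ground_states \<alpha> a d \<Delta> p \<A> \<longrightarrow>
                real (num_queries \<A>) \<ge> c * sqrt (real d) / \<Delta> \<and>
                c * sqrt (real d) / \<Delta> = c / (\<gamma> * \<Delta>))"
      by (auto simp: Let_def unique_ground_state_search_hamiltonian spectral_gap_search_hamiltonian
          uniform_state_overlap)
  qed (use c in \<open>auto simp: d\<^sub>0_def\<close>)
qed

end
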